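(* Let $(X,\tau,\mathsf d)$ be an extended metric-topological space, $\mathfrak m\in\mathcal P(X)$, and let $(\mathsf d_i)_{i\in I}$ be a monotone family ($I$ a directed set, $\mathsf d_i\le\mathsf d_j$ for $i\le j$) of bounded $(\tau\times\tau)$-continuous semidistances $\mathsf d_i:X\times X\to[0,\infty)$ with $\mathsf d=\sup_{i\in I}\mathsf d_i$. Let $\mathrm{Ch}$ be the Cheeger energy of $(X,\tau,\mathsf d,\mathfrak m)$ and $\mathrm{Ch}_i$ the Cheeger energy associated with $\mathsf d_i$. Then $\mathrm{Ch}$ coincides with the largest $L^2(X,\mathfrak m)$-lower semicontinuous functional smaller than (i.e. $\le$) $\inf_{i\in I}\mathrm{Ch}_i$.
   Context: An extended metric space $(X,\mathsf d)$ is a set with a symmetric $\mathsf d:X\times X\to[0,\infty]$ satisfying the triangle inequality and $\mathsf d(x,y)=0$ iff $x=y$; for a semidistance the last condition is weakened to $\mathsf d(x,x)=0$. For a Hausdorff topology $\tau$ on $X$, $\mathrm{Lip}_b(X,\tau,\mathsf d)$ is the set of bounded, $\mathsf d$-Lipschitz, $\tau$-continuous functions $f:X\to\mathbb R$. $(X,\tau,\mathsf d)$ is an extended metric-topological space if (a) $\mathsf d$ is the supremum of a family of $(\tau\times\tau)$-continuous bounded semidistances $X\times X\to[0,\infty)$; (b) $\tau$ is generated by $\mathrm{Lip}_b(X,\tau,\mathsf d)$. $\mathcal P(X)$ is the set of Radon probability measures on the Borel sets of $\tau$. $(X,\tau,\mathsf d,\mathfrak m)$ with $\mathfrak m\in\mathcal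 P(X)$ is then an extended metric measure space. Cheeger energy of an extended metric measure space $(X,\tau,\mathsf d,\mathfrak m)$: for $f\in\mathrm{Lip}_b(X,\tau,\mathsf d)$, $\mathrm{Lip}_a(f,x)=\lim_{r\downarrow0}\sup\{|f(y)-f(z)|/\mathsf d(y,z):\ \mathsf d(y,x)\vee\mathsf d(z,x)<r,\ \mathsf d(y,z)>0\}$ ($=0$ at $\mathsf d$-isolated points). For $f\in L^2(X,\mathfrak m)$, $\mathrm{Ch}(f)=\inf\liminf_{n}\int g_n^2\,d\mathfrak m\in[0,\infty]$, the infimum over all sequences $f_n\in\mathrm{Lip}_b(X,\tau,\mathsf d)$ with $f_n\to f$ in $L^2(X,\mathfrak m)$ and all $\mathfrak m$-measurable $g_n\ge\mathrm{Lip}_a(f_n,\cdot)$ $\mathfrak m$-a.e. Definition of $\mathrm{Ch}_i$: let $(X_i,\tilde{\mathsf d}_i)$ be the metric space quotient of $(X,\mathsf d_i)$ (identifying $x,y$ with $\mathsf d_i(x,y)=0$), $\pi^i:X\to X_i$ the projection, $\tau_i$ the topology induced by $\tilde{\mathsf d}_i$, $\mathfrak m_i=(\pi^i)_\sharp\mathfrak m$, and $\widetilde{\mathrm{Ch}}_i$ the Cheeger energy of $(X_i,\tau_i,\tilde{\mathsf d}_i,\mathfrak m_i)$. Then, for $f\in L^2(X,\mathfrak m)$, $\mathrm{Ch}_i(f)=\widetilde{\mathrm{Ch}}_i(g)$ if $f=g\circ\pi^i$ with $g\in L^2(X_i,\mathfrak m_i)$, and $\mathrm{Ch}_i(f)=+\infty$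 if $f$ is not of this form. *)

theory Defs
  imports "HOL-Probability.Probability"
begin

text \<open>The underlying set of a space is \<open>topspace T\<close>; values of distances and functions outside
  of it are irrelevant.\<close>

section \<open>Extended metric-topological spaces\<close>

definition extended_metric_on :: "'a set \<Rightarrow> ('a \<Rightarrow> 'a \<Rightarrow> ennreal) \<Rightarrow> bool" where
  "extended_metric_on X d \<longleftrightarrow>
     (\<forall>x\<in>X. \<forall>y\<in>X. d x y = d y x) \<and>
     (\<forall>x\<in>X. \<forall>y\<in>X. d x y = 0 \<longleftrightarrow> x = y) \<and>
     (\<forall>x\<in>X. \<forall>y\<in>X. \<forall>z\<in>X. d x z \<le> d x y + d y z)"

definition semidistance_on :: "'a set \<Rightarrow> ('a \<Rightarrow> 'a \<Rightarrow> real) \<Rightarrow> bool" where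
  "semidistance_on X \<delta> \<longleftrightarrow>
     (\<forall>x\<in>X. \<forall>y\<in>X. 0 \<le> \<delta> x y) \<and>
     (\<forall>x\<in>X. \<forall>y\<in>X. \<delta> x y = \<delta> y x) \<and>
     (\<forall>x\<in>X. \<delta> x x = 0) \<and>
     (\<forall>x\<in>X. \<forall>y\<in>X. \<forall>z\<in>X. \<delta> x z \<le> \<delta> x y + \<delta> y z)"

definition cont_bounded_semidistance :: "'a topology \<Rightarrow> ('a \<Rightarrow> 'a \<Rightarrow> real) \<Rightarrow> bool" where
  "cont_bounded_semidistance T \<delta> \<longleftrightarrow>
     semidistance_on (topspace T) \<delta> \<and>
     continuous_map (prod_topology T T) euclideanreal (\<lambda>(x, y). \<delta> x y) \<and>
     (\<exists>B. \<forall>x\<in>topspace T. \<forall>y\<in>topspace T. \<delta> x y \<le> B)"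

text \<open>The convention \<open>0 * \<infinity> = 0\<close> of \<^typ>\<open>ennreal\<close> is harmless here: a function that satisfies the
  inequality with \<open>L = 0\<close> is constant.\<close>

definition Lip_b :: "'a topology \<Rightarrow> ('a \<Rightarrow> 'a \<Rightarrow> ennreal) \<Rightarrow> ('a \<Rightarrow> real) set" where
  "Lip_b T d = {f. continuous_map T euclideanreal f \<and> bounded (f ` topspace T) \<and>
     (\<exists>L\<ge>0. \<forall>x\<in>topspace T. \<forall>y\<in>topspace T. ennreal \<bar>f x - f y\<bar> \<le> ennreal L * d x y)}"

definition extended_metric_topological_space ::
    "'a topology \<Rightarrow> ('a \<Rightarrow> 'a \<Rightarrow> ennreal) \<Rightarrow> bool" where
  "extended_metric_topological_space T d \<longleftrightarrow>
     Hausdorff_space T \<and>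
     extended_metric_on (topspace T) d \<and>
     (\<exists>D. (\<forall>\<delta>\<in>D. cont_bounded_semidistance T \<delta>) \<and>
          (\<forall>x\<in>topspace T. \<forall>y\<in>topspace T. d x y = (SUP \<delta>\<in>D. ennreal (\<delta> x y)))) \<and>
     T = topology_generated_by {f -` U \<inter> topspace T | f U. f \<in> Lip_b T d \<and> open U}"

definition borel_of_topology :: "'a topology \<Rightarrow> 'a measure" where
  "borel_of_topology T = sigma (topspace T) {U. openin T U}"

definition radon_prob_measure :: "'a topology \<Rightarrow> 'a measure \<Rightarrow> bool" where
  "radon_prob_measure T M \<longleftrightarrow>
     prob_space M \<and> space M = topspace T \<and> sets M = sets (borel_of_topology T) \<and>
     (\<forall>B\<in>sets M. emeasure M B = (SUP K\<in>{K. compactin T K \<and> K \<subseteq> B}. emeasure M K))"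

section \<open>The space \<open>L\<^sup>2\<close>\<close>

text \<open>Elements of \<open>L\<^sup>2\<close> are represented by functions. A functional that is lower semicontinuous for
  the \<open>L\<^sup>2\<close> seminorm is automatically invariant under a.e. equality
  (\<open>L2_lsc_AE_cong\<close> below), i.e. a functional on the space of classes.\<close>

definition L2_set_of :: "'a measure \<Rightarrow> ('a \<Rightarrow> real) set" where
  "L2_set_of M = {f \<in> borel_measurable M. integrable M (\<lambda>x. (f x)\<^sup>2)}"

definition L2_converges :: "'a measure \<Rightarrow> (nat \<Rightarrow> 'a \<Rightarrow> real) \<Rightarrow> ('a \<Rightarrow> real) \<Rightarrow> bool" where
  "L2_converges M fs f \<longleftrightarrow>
     (\<forall>n. fs n \<in> L2_set_of M) \<and> f \<in> L2_set_of M \<and>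
     (\<lambda>n. \<integral>\<^sup>+x. ennreal ((fs n x - f x)\<^sup>2) \<partial>M) \<longlonglongrightarrow> 0"

definition L2_lsc :: "'a measure \<Rightarrow> (('a \<Rightarrow> real) \<Rightarrow> ereal) \<Rightarrow> bool" where
  "L2_lsc M F \<longleftrightarrow>
     (\<forall>fs f. L2_converges M fs f \<longrightarrow> F f \<le> liminf (\<lambda>n. F (fs n)))"

text \<open>\<open>F\<close> is the largest \<open>L\<^sup>2\<close>-lower semicontinuous functional below \<open>G\<close>.\<close>

definition largest_L2_lsc_below ::
    "'a measure \<Rightarrow> (('a \<Rightarrow> real) \<Rightarrow> ereal) \<Rightarrow> (('a \<Rightarrow> real) \<Rightarrow> ereal) \<Rightarrow> bool" where
  "largest_L2_lsc_below M G F \<longleftrightarrow>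
     L2_lsc M F \<and> (\<forall>f\<in>L2_set_of M. F f \<le> G f) \<and>
     (\<forall>H. L2_lsc M H \<and> (\<forall>f\<in>L2_set_of M. H f \<le> G f) \<longrightarrow> (\<forall>f\<in>L2_set_of M. H f \<le> F f))"

lemma L2_lsc_AE_cong:
  assumes F: "L2_lsc M F" and fg: "f \<in> L2_set_of M" "g \<in> L2_set_of M" "AE x in M. f x = g x"
  shows "F f = F g"
proof -
  have *: "F u \<le> F v"
    if uv: "u \<in> L2_set_of M" "v \<in> L2_set_of M" "AE x in M. u x = v x" for u v
  proof -
    have "(\<integral>\<^sup>+x. ennreal ((v x - u x)\<^sup>2) \<partial>M) = (\<integral>\<^sup>+x. 0 \<partial>M)"
      by (rule nn_integral_cong_AE) (use uv(3) in auto)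
    then have "L2_converges M (\<lambda>_. v) u"
      using uv by (simp add: L2_converges_def)
    with F have "F u \<le> liminf (\<lambda>_. F v)"
      unfolding L2_lsc_def by blast
    then show ?thesis
      by (simp add: Liminf_const)
  qed
  have "AE x in M. g x = f x"
    using fg(3) by auto
  with fg show ?thesis
    by (intro antisym *)
qed

section \<open>Cheeger energy\<close>

text \<open>At \<open>d\<close>-isolated points the set below is eventually empty, and its supremum in
  \<^typ>\<open>ennreal\<close> is \<open>0\<close>.\<close>

definition Lip_a :: "'a topology \<Rightarrow> ('a \<Rightarrow> 'a \<Rightarrow> ennreal) \<Rightarrow> ('a \<Rightarrow> real) \<Rightarrow> 'a \<Rightarrow> ennreal" where
  "Lip_a T d f x = Lim (at_right (0::real)) (\<lambda>r.
     Sup {ennreal \<bar>f y - f z\<bar> / d y z | y z.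
       y \<in> topspace T \<and> z \<in> topspace T \<and> max (d y x) (d z x) < ennreal r \<and> 0 < d y z})"

definition Cheeger ::
    "'a topology \<Rightarrow> ('a \<Rightarrow> 'a \<Rightarrow> ennreal) \<Rightarrow> 'a measure \<Rightarrow> ('a \<Rightarrow> real) \<Rightarrow> ennreal" where
  "Cheeger T d M f = Inf {liminf (\<lambda>n. \<integral>\<^sup>+x. (g n x)\<^sup>2 \<partial>completion M) | fs g.
     (\<forall>n. fs n \<in> Lip_b T d) \<and> L2_converges M fs f \<and>
     (\<forall>n. g n \<in> borel_measurable (completion M) \<and> (AE x in M. Lip_a T d (fs n) x \<le> g n x))}"

section \<open>Cheeger energy associated with a semidistance\<close>

definition semidist_rel :: "'a set \<Rightarrow> ('a \<Rightarrow> 'a \<Rightarrow> real) \<Rightarrow> ('a \<times> 'a) set" where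
  "semidist_rel X \<delta> = {(x, y). x \<in> X \<and> y \<in> X \<and> \<delta> x y = 0}"

definition quot_space :: "'a set \<Rightarrow> ('a \<Rightarrow> 'a \<Rightarrow> real) \<Rightarrow> 'a set set" where
  "quot_space X \<delta> = X // semidist_rel X \<delta>"

definition quot_proj :: "'a set \<Rightarrow> ('a \<Rightarrow> 'a \<Rightarrow> real) \<Rightarrow> 'a \<Rightarrow> 'a set" where
  "quot_proj X \<delta> x = semidist_rel X \<delta> `` {x}"

text \<open>The common value of \<open>\<delta>\<close> on pairs of representatives, see \<open>quot_dist_proj\<close>; the value outside of
  the quotient is chosen so that the library's \<^locale>\<open>Metric_space\<close> applies.\<close>

definition quot_dist :: "'a set \<Rightarrow> ('a \<Rightarrow> 'a \<Rightarrow> real) \<Rightarrow> 'a set \<Rightarrow> 'a set \<Rightarrow> real" where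
  "quot_dist X \<delta> A B =
     (if A \<in> quot_space X \<delta> \<and> B \<in> quot_space X \<delta>
      then the_elem ((\<lambda>(x, y). \<delta> x y) ` (A \<times> B)) else 0)"

definition quot_topology :: "'a set \<Rightarrow> ('a \<Rightarrow> 'a \<Rightarrow> real) \<Rightarrow> 'a set topology" where
  "quot_topology X \<delta> = Metric_space.mtopology (quot_space X \<delta>) (quot_dist X \<delta>)"

definition quot_measure :: "'a topology \<Rightarrow> ('a \<Rightarrow> 'a \<Rightarrow> real) \<Rightarrow> 'a measure \<Rightarrow> 'a set measure" where
  "quot_measure T \<delta> M =
     distr M (borel_of_topology (quot_topology (topspace T) \<delta>)) (quot_proj (topspace T) \<delta>)"

text \<open>The identity \<open>f = g \<circ> \<pi>\<close> is one in \<open>L\<^sup>2\<close>, hence a.e.; it determines \<open>g\<close> up to a null set of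
  the image measure, so the choice of \<open>g\<close> does not matter.\<close>

definition Cheeger_semidist ::
    "'a topology \<Rightarrow> ('a \<Rightarrow> 'a \<Rightarrow> real) \<Rightarrow> 'a measure \<Rightarrow> ('a \<Rightarrow> real) \<Rightarrow> ennreal" where
  "Cheeger_semidist T \<delta> M f =
     (let factors = (\<lambda>g. g \<in> L2_set_of (quot_measure T \<delta> M) \<and>
                         (AE x in M. f x = g (quot_proj (topspace T) \<delta> x)))
      in if \<exists>g. factors g
         then Cheeger (quot_topology (topspace T) \<delta>) (\<lambda>A B. ennreal (quot_dist (topspace T) \<delta> A B))
                (quot_measure T \<delta> M) (SOME g. factors g)
         else \<infinity>)"

lemma quot_space_eq: "quot_space X \<delta> = quot_proj X \<delta> ` X"
  by (auto simp: quot_space_def quot_proj_def quotient_def)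

lemma quot_dist_proj:
  assumes \<delta>: "semidistance_on X \<delta>" and xy: "x \<in> X" "y \<in> X"
  shows "quot_dist X \<delta> (quot_proj X \<delta> x) (quot_proj X \<delta> y) = \<delta> x y"
proof -
  have *: "\<delta> u v = \<delta> x y" if "u \<in> X" "v \<in> X" "\<delta> x u = 0" "\<delta> y v = 0" for u v
  proof -
    have "\<delta> u v \<le> \<delta> u x + \<delta> x v" "\<delta> x v \<le> \<delta> x y + \<delta> y v"
      "\<delta> x y \<le> \<delta> x u + \<delta> u y" "\<delta> u y \<le> \<delta> u v + \<delta> v y" "\<delta> u x = \<delta> x u" "\<delta> v y = \<delta> y v"
      using \<delta> xy that unfolding semidistance_on_def by blast+
    with that show ?thesis by linarith
  qed
  have "\<delta> x x = 0" "\<delta> y y = 0"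
    using \<delta> xy by (auto simp: semidistance_on_def)
  then have mem: "x \<in> quot_proj X \<delta> x" "y \<in> quot_proj X \<delta> y"
    using xy by (simp_all add: quot_proj_def semidist_rel_def)
  have eq: "\<delta> u v = \<delta> x y" if "u \<in> quot_proj X \<delta> x" "v \<in> quot_proj X \<delta> y" for u v
    by (rule *) (use that in \<open>simp_all add: quot_proj_def semidist_rel_def\<close>)
  have "(\<lambda>(x, y). \<delta> x y) ` (quot_proj X \<delta> x \<times> quot_proj X \<delta> y) = {\<delta> x y}"
    (is "?f ` ?S = _")
  proof
    show "?f ` ?S \<subseteq> {\<delta> x y}"
      by (clarsimp, erule (1) eq)
    have "?f (x, y) \<in> ?f ` ?S"
      by (rule imageI) (use mem in simp)
    then show "{\<delta> x y} \<subseteq> ?f ` ?S"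
      by simp
  qed
  then show ?thesis
    using xy by (simp add: quot_dist_def quot_space_eq)
qed

lemma quot_proj_eq_iff:
  assumes \<delta>: "semidistance_on X \<delta>" and xy: "x \<in> X" "y \<in> X"
  shows "quot_proj X \<delta> x = quot_proj X \<delta> y \<longleftrightarrow> \<delta> x y = 0"
proof
  assume "quot_proj X \<delta> x = quot_proj X \<delta> y"
  moreover have "y \<in> quot_proj X \<delta> y"
    using \<delta> xy by (simp add: quot_proj_def semidist_rel_def semidistance_on_def)
  ultimately show "\<delta> x y = 0"
    by (auto simp: quot_proj_def semidist_rel_def)
next
  assume xy0: "\<delta> x y = 0"
  have "\<delta> x z = 0 \<longleftrightarrow> \<delta> y z = 0" if z: "z \<in> X" for z
  proof -
    have "\<delta> x z \<le> \<delta> x y + \<delta> y z" "\<delta> y z \<le> \<delta> y x + \<delta> x z" "\<delta> y x = \<delta> x y" "0 \<le> \<delta> x z" "0 \<le> \<delta> y z"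
      using \<delta> xy z unfolding semidistance_on_def by blast+
    with xy0 show ?thesis by linarith
  qed
  then show "quot_proj X \<delta> x = quot_proj X \<delta> y"
    using xy by (auto simp: quot_proj_def semidist_rel_def)
qed

lemma Metric_space_quot:
  assumes \<delta>: "semidistance_on X \<delta>"
  shows "Metric_space (quot_space X \<delta>) (quot_dist X \<delta>)"
proof
  fix A B C
  have out: "quot_dist X \<delta> A B = 0" "quot_dist X \<delta> B A = 0"
    if "\<not> (A \<in> quot_space X \<delta> \<and> B \<in> quot_space X \<delta>)"
    using that by (auto simp: quot_dist_def)
  show "0 \<le> quot_dist X \<delta> A B"
  proof (cases "A \<in> quot_space X \<delta> \<and> B \<in> quot_space X \<delta>")
    case True
    then show ?thesis
      using \<delta> by (auto simp: quot_space_eq quot_dist_proj semidistance_on_def)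
  qed (simp add: out)
  show "quot_dist X \<delta> A B = quot_dist X \<delta> B A"
  proof (cases "A \<in> quot_space X \<delta> \<and> B \<in> quot_space X \<delta>")
    case True
    then show ?thesis
      using \<delta> by (auto simp: quot_space_eq quot_dist_proj semidistance_on_def)
  qed (simp add: out)
  assume A: "A \<in> quot_space X \<delta>" and B: "B \<in> quot_space X \<delta>"
  obtain x y where x: "x \<in> X" "A = quot_proj X \<delta> x" and y: "y \<in> X" "B = quot_proj X \<delta> y"
    using A B by (auto simp only: quot_space_eq)
  show "quot_dist X \<delta> A B = 0 \<longleftrightarrow> A = B"
    by (simp only: x y quot_dist_proj[OF \<delta>] quot_proj_eq_iff[OF \<delta>])
  assume C: "C \<in> quot_space X \<delta>"
  then obtain z where z: "z \<in> X" "C = quot_proj X \<delta> z"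
    by (auto simp only: quot_space_eq)
  have "\<delta> x z \<le> \<delta> x y + \<delta> y z"
    using \<delta> x y z unfolding semidistance_on_def by blast
  then show "quot_dist X \<delta> A C \<le> quot_dist X \<delta> A B + quot_dist X \<delta> B C"
    by (simp only: x y z quot_dist_proj[OF \<delta>])
qed

lemma continuous_map_quot_proj:
  assumes \<delta>: "cont_bounded_semidistance T \<delta>"
  shows "continuous_map T (quot_topology (topspace T) \<delta>) (quot_proj (topspace T) \<delta>)"
proof -
  let ?X = "topspace T"
  have sd: "semidistance_on ?X \<delta>"
    and cont: "continuous_map (prod_topology T T) euclideanreal (\<lambda>(x, y). \<delta> x y)"
    using \<delta> by (auto simp: cont_bounded_semidistance_def)
  interpret Q: Metric_space "quot_space ?X \<delta>" "quot_dist ?X \<delta>"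
    by (rule Metric_space_quot[OF sd])
  show ?thesis
    unfolding quot_topology_def Q.continuous_map_to_metric
  proof (intro ballI allI impI)
    fix x and \<epsilon> :: real
    assume x: "x \<in> ?X" and "\<epsilon> > 0"
    let ?U = "{y \<in> ?X. \<delta> x y \<in> {..<\<epsilon>}}"
    have "continuous_map T (prod_topology T T) (\<lambda>y. (x, y))"
      using x by (intro continuous_map_pairedI) auto
    from continuous_map_compose[OF this cont]
    have "continuous_map T euclideanreal (\<lambda>y. \<delta> x y)"
      by (simp add: o_def)
    then have "openin T ?U"
      by (rule openin_continuous_map_preimage) simp
    moreover have "x \<in> ?U"
      using x \<open>\<epsilon> > 0\<close> sd by (simp add: semidistance_on_def)
    moreover have "quot_proj ?X \<delta> y \<in> Q.mball (quot_proj ?X \<delta> x) \<epsilon>" if "y \<in> ?U" for y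
      using that x by (simp add: Q.in_mball quot_dist_proj[OF sd]) (simp add: quot_space_eq)
    ultimately show "\<exists>U. openin T U \<and> x \<in> U \<and> (\<forall>y\<in>U. quot_proj ?X \<delta> y \<in> Q.mball (quot_proj ?X \<delta> x) \<epsilon>)"
      by blast
  qed
qed

lemma measurable_quot_proj:
  assumes \<delta>: "cont_bounded_semidistance T \<delta>"
    and M: "space M = topspace T" "sets M = sets (borel_of_topology T)"
  shows "quot_proj (topspace T) \<delta> \<in>
    measurable M (borel_of_topology (quot_topology (topspace T) \<delta>))"
  unfolding borel_of_topology_def
proof (rule measurable_measure_of)
  let ?Q = "quot_topology (topspace T) \<delta>"
  have c: "continuous_map T ?Q (quot_proj (topspace T) \<delta>)"
    by (rule continuous_map_quot_proj[OF \<delta>])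
  show "{U. openin ?Q U} \<subseteq> Pow (topspace ?Q)"
    by (auto dest: openin_subset)
  show "quot_proj (topspace T) \<delta> \<in> space M \<rightarrow> topspace ?Q"
    using c M by (auto simp: continuous_map_def)
  fix U assume "U \<in> {U. openin ?Q U}"
  then have "openin T {x \<in> topspace T. quot_proj (topspace T) \<delta> x \<in> U}"
    using c by (auto intro: openin_continuous_map_preimage)
  moreover have "quot_proj (topspace T) \<delta> -` U \<inter> space M =
      {x \<in> topspace T. quot_proj (topspace T) \<delta> x \<in> U}"
    using M by auto
  moreover have "{U. openin T U} \<subseteq> Pow (topspace T)"
    by (auto dest: openin_subset)
  ultimately show "quot_proj (topspace T) \<delta> -` U \<inter> space M \<in> sets M"
    unfolding M(2) borel_of_topology_def by (simp add: sets_measure_of sigma_sets.Basic)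
qed

section \<open>Directed sets\<close>

definition directed_set :: "'i set \<Rightarrow> ('i \<Rightarrow> 'i \<Rightarrow> bool) \<Rightarrow> bool" where
  "directed_set I le \<longleftrightarrow> I \<noteq> {} \<and>
     (\<forall>i\<in>I. le i i) \<and>
     (\<forall>i\<in>I. \<forall>j\<in>I. \<forall>k\<in>I. le i j \<longrightarrow> le j k \<longrightarrow> le i k) \<and>
     (\<forall>i\<in>I. \<forall>j\<in>I. \<exists>k\<in>I. le i k \<and> le j k)"

end

theory Submission
  imports Defs
begin

text \<open>Lower semicontinuity of the Cheeger energy is a diagonal argument, and \<open>Ch \<le> Ch\<^sub>i\<close> holds because
  pulling back along the projection to the quotient of \<open>\<delta> \<le> d\<close> does not increase the asymptotic
  Lipschitz constant. For maximality let \<open>H\<close> be lower semicontinuous and below every \<open>Ch\<^sub>i\<close>; it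
  suffices to bound \<open>H h\<close> by the integral of \<open>g\<^sup>2\<close> for \<open>h \<in> Lip_b\<close> and \<open>g \<ge> Lip_a h\<close>. By inner
  regularity, up to measure \<open>e\<close> the space consists of finitely many disjoint compact sets \<open>K\<^sub>k\<close> on
  which \<open>h\<close> is \<open>c\<^sub>k\<close>-Lipschitz for \<open>d\<close>, with \<open>c\<^sub>k \<le> g + e\<close>. By compactness and monotonicity,
  for large \<open>i\<close> the \<open>K\<^sub>k\<close> are separated for \<open>d\<^sub>i\<close> and \<open>h\<close> is \<open>c\<^sub>k\<close>-Lipschitz for \<open>d\<^sub>i\<close> on \<open>K\<^sub>k\<close> up to a
  small additive error. The McShane extensions of the restrictions of \<open>h\<close> to the \<open>K\<^sub>k\<close> can then be
  glued to a \<open>d\<^sub>i\<close>-Lipschitz function close to \<open>h\<close> that is \<open>c\<^sub>k\<close>-Lipschitz near \<open>K\<^sub>k\<close> and whose global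
  Lipschitz constant stays bounded, so that its energy is at most the integral of \<open>g\<^sup>2\<close> plus a small
  error.\<close>

section \<open>Asymptotic Lipschitz constants and competitors\<close>

definition Lip_ball :: "'a topology \<Rightarrow> ('a \<Rightarrow> 'a \<Rightarrow> ennreal) \<Rightarrow> ('a \<Rightarrow> real) \<Rightarrow> 'a \<Rightarrow> real \<Rightarrow> ennreal" where
  "Lip_ball T d f x r = Sup {ennreal \<bar>f y - f z\<bar> / d y z | y z.
     y \<in> topspace T \<and> z \<in> topspace T \<and> max (d y x) (d z x) < ennreal r \<and> 0 < d y z}"

lemma Lip_ball_mono:
  assumes "r \<le> s"
  shows "Lip_ball T d f x r \<le> Lip_ball T d f x s"
  unfolding Lip_ball_def
  by (rule Sup_subset_mono) (use less_le_trans[OF _ ennreal_leI[OF assms]] in blast)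

text \<open>By \<open>Lip_ball_mono\<close> the supremum shrinks with the radius, so the limit at 0
  is an infimum. A bound at a single radius then bounds \<open>Lip_a\<close>, and a strict bound on
  \<open>Lip_a\<close> yields such a radius.\<close>

lemma Lip_a_eq_INF: "Lip_a T d f x = (INF r\<in>{0<..}. Lip_ball T d f x r)"
proof -
  let ?S = "Lip_ball T d f x"
  have "(?S \<longlongrightarrow> (INF r\<in>{0<..}. ?S r)) (at_right 0)"
  proof (rule order_tendstoI)
    fix a assume "a < (INF r\<in>{0<..}. ?S r)"
    then show "\<forall>\<^sub>F r in at_right 0. a < ?S r"
      by (auto simp: eventually_at_right_field less_INF_D intro!: exI[of _ 1])
  next
    fix a assume "(INF r\<in>{0<..}. ?S r) < a"
    then obtain r where "r > 0" "?S r < a"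
      by (auto simp: INF_less_iff)
    then show "\<forall>\<^sub>F r in at_right 0. ?S r < a"
      using le_less_trans[OF Lip_ball_mono] unfolding eventually_at_right_field
      by (meson less_imp_le)
  qed
  then show ?thesis
    unfolding Lip_a_def Lip_ball_def[symmetric] by (intro tendsto_Lim) simp_all
qed

lemma ennreal_divide_le_of_le_mult: "a \<le> c * b \<Longrightarrow> 0 < b \<Longrightarrow> a / b \<le> (c::ennreal)"
  \<comment> \<open>Dividing by \<open>\<infinity>\<close> gives 0 in \<open>ennreal\<close>, so
    pairs at infinite distance impose nothing.\<close>
  by (cases "b = \<infinity>") (auto intro: divide_le_posI_ennreal simp: mult.commute)

lemma Lip_a_leI:
  assumes r: "r > 0"
    and le: "\<And>y z. y \<in> topspace T \<Longrightarrow> z \<in> topspace T \<Longrightarrow> d y x < ennreal r \<Longrightarrow> d z x < ennreal r \<Longrightarrow>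
      0 < d y z \<Longrightarrow> ennreal \<bar>f y - f z\<bar> \<le> c * d y z"
  shows "Lip_a T d f x \<le> c"
proof -
  have "Lip_a T d f x \<le> Lip_ball T d f x r"
    unfolding Lip_a_eq_INF using r by (intro INF_lower) simp
  also have "\<dots> \<le> c"
    unfolding Lip_ball_def
    by (rule Sup_least) (auto intro!: ennreal_divide_le_of_le_mult le)
  finally show ?thesis .
qed

lemma Lip_a_lessE:
  assumes "Lip_a T d f x < c"
  obtains r where "r > 0" "\<And>y z. y \<in> topspace T \<Longrightarrow> z \<in> topspace T \<Longrightarrow>
    d y x < ennreal r \<Longrightarrow> d z x < ennreal r \<Longrightarrow> 0 < d y z \<Longrightarrow> ennreal \<bar>f y - f z\<bar> / d y z \<le> c"
proof -
  obtain r where r: "r > 0" "Lip_ball T d f x r < c"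
    using assms by (auto simp: Lip_a_eq_INF INF_less_iff)
  show thesis
  proof (rule that[OF r(1)])
    fix y z assume "y \<in> topspace T" "z \<in> topspace T" "d y x < ennreal r" "d z x < ennreal r" "0 < d y z"
    then have "ennreal \<bar>f y - f z\<bar> / d y z \<le> Lip_ball T d f x r"
      unfolding Lip_ball_def by (intro Sup_upper) auto
    with r show "ennreal \<bar>f y - f z\<bar> / d y z \<le> c"
      by (meson le_less_trans less_imp_le)
  qed
qed

section \<open>Square-integrable functions and lower semicontinuous functionals\<close>

lemma continuous_map_borel_measurable:
  assumes "space M = topspace T" "sets M = sets (borel_of_topology T)"
    and f: "continuous_map T euclidean f"
  shows "f \<in> borel_measurable M"
proof (rule borel_measurableI)
  fix S :: "'b set" assume "open S"
  then have "openin T {x \<in> topspace T. f x \<in> S}"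
    using f by (intro openin_continuous_map_preimage) auto
  moreover have "f -` S \<inter> space M = {x \<in> topspace T. f x \<in> S}"
    using assms by auto
  moreover have "{U. openin T U} \<subseteq> Pow (topspace T)"
    by (auto dest: openin_subset)
  ultimately show "f -` S \<inter> space M \<in> sets M"
    using assms(2) by (auto simp: borel_of_topology_def sets_measure_of)
qed

lemma bounded_measurable_L2:
  assumes "finite_measure M" "f \<in> borel_measurable M" "\<And>x. x \<in> space M \<Longrightarrow> \<bar>f x\<bar> \<le> B"
  shows "f \<in> L2_set_of M"
proof -
  interpret finite_measure M by fact
  have "(f x)\<^sup>2 \<le> B\<^sup>2" if "x \<in> space M" for x
    using assms(3)[OF that] by (simp add: abs_le_square_iff[symmetric])
  then have "integrable M (\<lambda>x. (f x)\<^sup>2)"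
    using assms(2) by (intro integrable_const_bound[where B = "B\<^sup>2"]) auto
  then show ?thesis
    using assms by (simp add: L2_set_of_def)
qed

lemma L2_measurable: "f \<in> L2_set_of M \<Longrightarrow> f \<in> borel_measurable M"
  by (simp add: L2_set_of_def)

lemma L2_dist_triangle:
  assumes [measurable]: "f \<in> borel_measurable M" "g \<in> borel_measurable M" "h \<in> borel_measurable M"
  shows "(\<integral>\<^sup>+x. ennreal ((f x - h x)\<^sup>2) \<partial>M) \<le>
    2 * (\<integral>\<^sup>+x. ennreal ((f x - g x)\<^sup>2) \<partial>M) + 2 * (\<integral>\<^sup>+x. ennreal ((g x - h x)\<^sup>2) \<partial>M)"
proof -
  have "ennreal ((f x - h x)\<^sup>2) \<le> 2 * ennreal ((f x - g x)\<^sup>2) + 2 * ennreal ((g x - h x)\<^sup>2)" for x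
  proof -
    have "(f x - h x)\<^sup>2 \<le> 2 * (f x - g x)\<^sup>2 + 2 * (g x - h x)\<^sup>2"
      using zero_le_power2[of "(f x - g x) - (g x - h x)"] by (simp add: power2_eq_square algebra_simps)
    then have "ennreal ((f x - h x)\<^sup>2) \<le> ennreal (2 * (f x - g x)\<^sup>2 + 2 * (g x - h x)\<^sup>2)"
      by (rule ennreal_leI)
    then show ?thesis
      by (simp add: ennreal_plus ennreal_mult)
  qed
  then have "(\<integral>\<^sup>+x. ennreal ((f x - h x)\<^sup>2) \<partial>M) \<le>
      (\<integral>\<^sup>+x. 2 * ennreal ((f x - g x)\<^sup>2) + 2 * ennreal ((g x - h x)\<^sup>2) \<partial>M)"
    by (intro nn_integral_mono)
  then show ?thesis
    by (simp add: nn_integral_add nn_integral_cmult)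
qed

lemma L2_converges_choice:
  assumes f: "f \<in> L2_set_of M"
    and ex: "\<And>e. e > 0 \<Longrightarrow> \<exists>v\<in>L2_set_of M. (\<integral>\<^sup>+x. ennreal ((v x - f x)\<^sup>2) \<partial>M) < ennreal e \<and> P v"
  shows "\<exists>vs. L2_converges M vs f \<and> (\<forall>n. P (vs n))"
proof -
  have "\<forall>n. \<exists>v\<in>L2_set_of M. (\<integral>\<^sup>+x. ennreal ((v x - f x)\<^sup>2) \<partial>M) < ennreal (inverse (real (Suc n))) \<and> P v"
    by (intro allI ex) simp
  then obtain vs where vs: "\<And>n. vs n \<in> L2_set_of M"
      "\<And>n. (\<integral>\<^sup>+x. ennreal ((vs n x - f x)\<^sup>2) \<partial>M) < ennreal (inverse (real (Suc n)))" "\<And>n. P (vs n)"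
    by metis
  have "(\<lambda>n. ennreal (inverse (real (Suc n)))) \<longlonglongrightarrow> ennreal 0"
    by (intro tendsto_ennrealI LIMSEQ_inverse_real_of_nat)
  then have "(\<lambda>n. \<integral>\<^sup>+x. ennreal ((vs n x - f x)\<^sup>2) \<partial>M) \<longlonglongrightarrow> 0"
    unfolding ennreal_0
    by (rule tendsto_sandwich[OF _ _ tendsto_const, rotated 2])
      (use vs(2) in \<open>auto intro!: always_eventually less_imp_le\<close>)
  with vs f show ?thesis
    by (auto simp: L2_converges_def)
qed

text \<open>Approximants with errors \<open>1 / (n + 1)\<close> form a convergent sequence along
  which \<open>H\<close> stays below \<open>t\<close>; lower semicontinuity hands the bound to the
  limit.\<close>

lemma L2_lsc_leI:
  assumes H: "L2_lsc M H" and f: "f \<in> L2_set_of M"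
    and ex: "\<And>e. e > 0 \<Longrightarrow> \<exists>v\<in>L2_set_of M. (\<integral>\<^sup>+x. ennreal ((v x - f x)\<^sup>2) \<partial>M) < ennreal e \<and> H v \<le> t"
  shows "H f \<le> t"
proof -
  obtain vs where vs: "L2_converges M vs f" "\<And>n. H (vs n) \<le> t"
    using L2_converges_choice[OF f ex] by blast
  have "H f \<le> liminf (\<lambda>n. H (vs n))"
    using H vs(1) by (simp add: L2_lsc_def)
  also have "\<dots> \<le> t"
    using vs(2) by (intro Liminf_le always_eventually allI) auto
  finally show ?thesis .
qed

text \<open>Isolates one term of the sequences in \<open>Cheeger\<close>. Through
  \<open>Cheeger_leI\<close> and \<open>Cheeger_lessE\<close>, bounds on the energy become
  statements about such functions close to \<open>f\<close>, and no diagonal sequence has to be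
  built by hand. The bound \<open>g\<close> is Borel here, not merely measurable for the
  completion.\<close>

definition Cheeger_competitor ::
    "'a topology \<Rightarrow> ('a \<Rightarrow> 'a \<Rightarrow> ennreal) \<Rightarrow> 'a measure \<Rightarrow> ennreal \<Rightarrow> ('a \<Rightarrow> real) \<Rightarrow> bool" where
  "Cheeger_competitor T d M t u \<longleftrightarrow> u \<in> Lip_b T d \<and>
     (\<exists>g\<in>borel_measurable M. (AE x in M. Lip_a T d u x \<le> g x) \<and> (\<integral>\<^sup>+x. (g x)\<^sup>2 \<partial>M) \<le> t)"

lemma Cheeger_leI:
  assumes f: "f \<in> L2_set_of M"
    and ex: "\<And>e. e > 0 \<Longrightarrow> \<exists>u\<in>L2_set_of M.
      (\<integral>\<^sup>+x. ennreal ((u x - f x)\<^sup>2) \<partial>M) < ennreal e \<and> Cheeger_competitor T d M t u"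
  shows "Cheeger T d M f \<le> t"
proof -
  obtain us where us: "L2_converges M us f" "\<And>n. Cheeger_competitor T d M t (us n)"
    using L2_converges_choice[OF f ex] by blast
  then obtain g where g: "\<And>n. us n \<in> Lip_b T d" "\<And>n. g n \<in> borel_measurable M"
      "\<And>n. AE x in M. Lip_a T d (us n) x \<le> g n x" "\<And>n. (\<integral>\<^sup>+x. (g n x)\<^sup>2 \<partial>M) \<le> t"
    unfolding Cheeger_competitor_def by metis
  have "Cheeger T d M f \<le> liminf (\<lambda>n. \<integral>\<^sup>+x. (g n x)\<^sup>2 \<partial>completion M)"
    unfolding Cheeger_def using us(1) g
    by (intro Inf_lower) (auto intro!: exI[of _ us] exI[of _ g] measurable_completion)
  also have "\<dots> \<le> t"
    using g(4) by (intro Liminf_le always_eventually allI) (auto simp: nn_integral_completion)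
  finally show ?thesis .
qed

lemma Cheeger_lessE:
  assumes lt: "Cheeger T d M f < t" and e: "e > 0"
  obtains u where "u \<in> L2_set_of M" "(\<integral>\<^sup>+x. ennreal ((u x - f x)\<^sup>2) \<partial>M) < ennreal e"
    "Cheeger_competitor T d M t u"
proof -
  obtain fs g where lim: "liminf (\<lambda>n. \<integral>\<^sup>+x. (g n x)\<^sup>2 \<partial>completion M) < t"
    and fs: "\<And>n. fs n \<in> Lip_b T d" "L2_converges M fs f"
    and g: "\<And>n. g n \<in> borel_measurable (completion M)" "\<And>n. AE x in M. Lip_a T d (fs n) x \<le> g n x"
    using lt unfolding Cheeger_def Inf_less_iff by blast
  have "(\<lambda>n. \<integral>\<^sup>+x. ennreal ((fs n x - f x)\<^sup>2) \<partial>M) \<longlonglongrightarrow> 0"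
    using fs(2) by (simp add: L2_converges_def)
  then have "\<forall>\<^sub>F n in sequentially. (\<integral>\<^sup>+x. ennreal ((fs n x - f x)\<^sup>2) \<partial>M) < ennreal e"
    by (rule order_tendstoD) (use e in simp)
  \<comment> \<open>A liminf below \<open>t\<close> only gives infinitely many indices, but
    closeness to \<open>f\<close> holds eventually, so some index has both.\<close>
  moreover have "\<exists>\<^sub>F n in sequentially. (\<integral>\<^sup>+x. (g n x)\<^sup>2 \<partial>completion M) < t"
  proof (rule ccontr)
    assume "\<not> ?thesis"
    then have "\<forall>\<^sub>F n in sequentially. t \<le> (\<integral>\<^sup>+x. (g n x)\<^sup>2 \<partial>completion M)"
      by (simp add: not_frequently not_less)
    from Liminf_bounded[OF this] lim show False by simp
  qed
  ultimately obtain n where n: "(\<integral>\<^sup>+x. ennreal ((fs n x - f x)\<^sup>2) \<partial>M) < ennreal e"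
      "(\<integral>\<^sup>+x. (g n x)\<^sup>2 \<partial>M) < t"
    using frequently_eventually_conj[of _ sequentially] frequently_ex
    by (metis (mono_tags, lifting) nn_integral_completion)
  \<comment> \<open>Passes from the completion to a Borel function that agrees a.e.\<close>
  obtain g' where g': "g' \<in> borel_measurable M" "AE x in M. g n x = g' x"
    using completion_ex_borel_measurable[OF g(1)] by blast
  have "(\<integral>\<^sup>+x. (g n x)\<^sup>2 \<partial>M) = (\<integral>\<^sup>+x. (g' x)\<^sup>2 \<partial>M)"
    using g'(2) by (intro nn_integral_cong_AE) auto
  moreover have "AE x in M. Lip_a T d (fs n) x \<le> g' x"
    using g(2)[of n] g'(2) by eventually_elim simp
  ultimately have "Cheeger_competitor T d M t (fs n)"
    unfolding Cheeger_competitor_def using fs(1) g'(1) n(2) by (metis less_imp_le)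
  moreover have "fs n \<in> L2_set_of M"
    using fs(2) by (simp add: L2_converges_def)
  ultimately show thesis
    using that n(1) by blast
qed

text \<open>For \<open>t\<close> strictly above the liminf, some \<open>fs n\<close> close to
  \<open>f\<close> has energy below \<open>t\<close>; a competitor at level \<open>t\<close> close
  to this \<open>fs n\<close> is also close to \<open>f\<close>.\<close>

lemma L2_lsc_Cheeger: "L2_lsc M (\<lambda>f. enn2ereal (Cheeger T d M f))"
  unfolding L2_lsc_def
proof (intro allI impI)
  fix fs f assume conv: "L2_converges M fs f"
  have L2: "f \<in> L2_set_of M" "\<And>n. fs n \<in> L2_set_of M"
    and lim0: "(\<lambda>n. \<integral>\<^sup>+x. ennreal ((fs n x - f x)\<^sup>2) \<partial>M) \<longlonglongrightarrow> 0"
    using conv by (auto simp: L2_converges_def)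
  have *: "Cheeger T d M f \<le> liminf (\<lambda>n. Cheeger T d M (fs n))"
  proof (rule dense_ge)
    fix t assume t: "liminf (\<lambda>n. Cheeger T d M (fs n)) < t"
    have fr: "\<exists>\<^sub>F n in sequentially. Cheeger T d M (fs n) < t"
    proof (rule ccontr)
      assume "\<not> ?thesis"
      then have "\<forall>\<^sub>F n in sequentially. t \<le> Cheeger T d M (fs n)"
        by (simp add: not_frequently not_less)
      from Liminf_bounded[OF this] t show False by simp
    qed
    show "Cheeger T d M f \<le> t"
    proof (rule Cheeger_leI[OF L2(1)])
      fix e :: real assume e: "e > 0"
      \<comment> \<open>The triangle inequality for squared norms doubles both errors, so two errors
        of \<open>e / 4\<close> add up to \<open>e\<close>.\<close>
      have "\<forall>\<^sub>F n in sequentially. (\<integral>\<^sup>+x. ennreal ((fs n x - f x)\<^sup>2) \<partial>M) < ennreal (e / 4)"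
        using lim0 by (rule order_tendstoD) (use e in simp)
      from frequently_ex[OF frequently_eventually_conj[OF fr this]]
      obtain n where n: "Cheeger T d M (fs n) < t"
        "(\<integral>\<^sup>+x. ennreal ((fs n x - f x)\<^sup>2) \<partial>M) < ennreal (e / 4)"
        by blast
      obtain u where u: "u \<in> L2_set_of M" "Cheeger_competitor T d M t u"
        "(\<integral>\<^sup>+x. ennreal ((u x - fs n x)\<^sup>2) \<partial>M) < ennreal (e / 4)"
        by (rule Cheeger_lessE[OF n(1), of "e / 4"]) (use e in auto)
      have "(\<integral>\<^sup>+x. ennreal ((u x - f x)\<^sup>2) \<partial>M) \<le>
          2 * (\<integral>\<^sup>+x. ennreal ((u x - fs n x)\<^sup>2) \<partial>M) + 2 * (\<integral>\<^sup>+x. ennreal ((fs n x - f x)\<^sup>2) \<partial>M)"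
        using u(1) L2 by (intro L2_dist_triangle L2_measurable) auto
      also have "\<dots> < 2 * ennreal (e / 4) + 2 * ennreal (e / 4)"
        using u(3) n(2) by (intro add_strict_mono ennreal_mult_strict_left_mono) auto
      also have "\<dots> = ennreal 2 * ennreal (e / 4) + ennreal 2 * ennreal (e / 4)"
        by simp
      also have "\<dots> = ennreal e"
        using e by (simp only: ennreal_mult[symmetric] ennreal_plus[symmetric] mult_nonneg_nonneg) simp
      finally show "\<exists>u\<in>L2_set_of M. (\<integral>\<^sup>+x. ennreal ((u x - f x)\<^sup>2) \<partial>M) < ennreal e \<and>
          Cheeger_competitor T d M t u"
        using u by blast
    qed
  qed
  have "liminf (\<lambda>n. enn2ereal (Cheeger T d M (fs n))) = enn2ereal (liminf (\<lambda>n. Cheeger T d M (fs n)))"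
    by (rule Liminf_compose_continuous_mono)
      (auto intro!: monoI continuous_on_enn2ereal simp: less_eq_ennreal.rep_eq)
  with * show "enn2ereal (Cheeger T d M f) \<le> liminf (\<lambda>n. enn2ereal (Cheeger T d M (fs n)))"
    by (simp add: less_eq_ennreal.rep_eq)
qed

section \<open>The quotient by a semidistance\<close>

lemma ennreal_le_mult_of_divide_le:
  fixes a b c :: ennreal
  assumes "a / b \<le> c" "0 < b" "b < \<infinity>"
  shows "a \<le> c * b"
proof -
  have "a = a / b * b"
    using assms(2,3) by (simp add: ennreal_divide_times)
  also have "\<dots> \<le> c * b"
    by (intro mult_right_mono assms(1)) simp
  finally show ?thesis .
qed

locale semidist_quotient =
  fixes T :: "'a topology" and \<delta> :: "'a \<Rightarrow> 'a \<Rightarrow> real" and M :: "'a measure"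
  assumes cont_bounded: "cont_bounded_semidistance T \<delta>"
    and radon: "radon_prob_measure T M"
begin

abbreviation "X \<equiv> topspace T"
abbreviation "\<pi> \<equiv> quot_proj (topspace T) \<delta>"
abbreviation "Q \<equiv> quot_topology (topspace T) \<delta>"
abbreviation "dQ \<equiv> \<lambda>A B. ennreal (quot_dist (topspace T) \<delta> A B)"
abbreviation "N \<equiv> quot_measure T \<delta> M"

lemma semidist: "semidistance_on X \<delta>"
  using cont_bounded by (simp add: cont_bounded_semidistance_def)

lemma space_M: "space M = X" and sets_M: "sets M = sets (borel_of_topology T)"
  and prob_M: "prob_space M"
  using radon by (auto simp: radon_prob_measure_def)

sublocale Q: Metric_space "quot_space X \<delta>" "quot_dist X \<delta>"
  by (rule Metric_space_quot[OF semidist])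

lemma topspace_Q: "topspace Q = \<pi> ` X"
  unfolding quot_topology_def Q.topspace_mtopology by (rule quot_space_eq)

lemma dQ_proj: "x \<in> X \<Longrightarrow> y \<in> X \<Longrightarrow> dQ (\<pi> x) (\<pi> y) = ennreal (\<delta> x y)"
  by (simp add: quot_dist_proj[OF semidist])

lemma meas_proj: "\<pi> \<in> measurable M (borel_of_topology Q)"
  by (rule measurable_quot_proj[OF cont_bounded space_M sets_M])

lemma space_N: "space N = topspace Q" and sets_N: "sets N = sets (borel_of_topology Q)"
  by (auto simp: quot_measure_def borel_of_topology_def space_measure_of_conv)

lemma finite_measure_N: "finite_measure N"
proof -
  interpret prob_space M by (rule prob_M)
  show ?thesis
    unfolding quot_measure_def by (rule finite_measure_distr[OF meas_proj])
qed

lemma measurable_proj_N: "\<pi> \<in> measurable M N"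
  using meas_proj by (simp add: quot_measure_def)

lemma nn_integral_N:
  "f \<in> borel_measurable N \<Longrightarrow> integral\<^sup>N N f = (\<integral>\<^sup>+x. f (\<pi> x) \<partial>M)"
  unfolding quot_measure_def by (rule nn_integral_distr[OF meas_proj])

lemma AE_N_D: "(AE A in N. P A) \<Longrightarrow> AE x in M. P (\<pi> x)"
  unfolding quot_measure_def by (rule AE_distrD[OF meas_proj])

lemma L2_comp_proj:
  assumes "u \<in> L2_set_of N"
  shows "(\<lambda>x. u (\<pi> x)) \<in> L2_set_of M"
proof -
  have u: "u \<in> borel_measurable N" "integrable N (\<lambda>x. (u x)\<^sup>2)"
    using assms by (auto simp: L2_set_of_def)
  then have "integrable M (\<lambda>x. (u (\<pi> x))\<^sup>2)"
    unfolding quot_measure_def by (intro integrable_distr[OF meas_proj, of "\<lambda>x. (u x)\<^sup>2"])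
  with u(1) show ?thesis
    by (simp add: L2_set_of_def measurable_compose[OF measurable_proj_N])
qed

text \<open>As \<delta> is below \<open>d\<close>, a \<open>d\<close>-ball projects into the
  \<open>dQ\<close>-ball of the same radius, and a bound on increments by \<open>c\<close> times
  \<delta> implies the one by \<open>c\<close> times \<open>d\<close>.\<close>

lemma Lip_a_comp_proj_le:
  assumes le: "\<And>x y. x \<in> X \<Longrightarrow> y \<in> X \<Longrightarrow> ennreal (\<delta> x y) \<le> d x y" and x: "x \<in> X"
  shows "Lip_a T d (\<lambda>x. u (\<pi> x)) x \<le> Lip_a Q dQ u (\<pi> x)"
proof (rule dense_ge)
  fix c assume "Lip_a Q dQ u (\<pi> x) < c"
  then obtain r where r: "r > 0" "\<And>A B. A \<in> topspace Q \<Longrightarrow> B \<in> topspace Q \<Longrightarrow>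
      dQ A (\<pi> x) < ennreal r \<Longrightarrow> dQ B (\<pi> x) < ennreal r \<Longrightarrow> 0 < dQ A B \<Longrightarrow>
      ennreal \<bar>u A - u B\<bar> / dQ A B \<le> c"
    by (rule Lip_a_lessE) blast
  show "Lip_a T d (\<lambda>x. u (\<pi> x)) x \<le> c"
  proof (rule Lip_a_leI[OF r(1)])
    fix y z assume yz: "y \<in> X" "z \<in> X" "d y x < ennreal r" "d z x < ennreal r" "0 < d y z"
    show "ennreal \<bar>u (\<pi> y) - u (\<pi> z)\<bar> \<le> c * d y z"
    \<comment> \<open>Points at positive \<open>d\<close>-distance may be identified in the
      quotient; there the difference quotient for \<open>dQ\<close> says nothing, but the increment
      is zero.\<close>
    proof (cases "\<delta> y z = 0")
      case True
      then have "\<pi> y = \<pi> z"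
        using yz by (simp add: quot_proj_eq_iff[OF semidist])
      then show ?thesis by simp
    next
      case False
      then have pos: "0 < \<delta> y z"
        using semidist yz by (auto simp: semidistance_on_def order_less_le)
      have "ennreal \<bar>u (\<pi> y) - u (\<pi> z)\<bar> / dQ (\<pi> y) (\<pi> z) \<le> c"
        using yz x pos le[OF yz(1) x] le[OF yz(2) x]
        by (intro r(2)) (auto simp: topspace_Q quot_dist_proj[OF semidist] intro: le_less_trans)
      then have "ennreal \<bar>u (\<pi> y) - u (\<pi> z)\<bar> \<le> c * ennreal (\<delta> y z)"
        using pos yz by (intro ennreal_le_mult_of_divide_le) (auto simp: dQ_proj)
      also have "\<dots> \<le> c * d y z"
        by (intro mult_left_mono le yz) simp
      finally show ?thesis .
    qed
  qed
qed

lemma Lip_b_comp_proj: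
  assumes le: "\<And>x y. x \<in> X \<Longrightarrow> y \<in> X \<Longrightarrow> ennreal (\<delta> x y) \<le> d x y" and u: "u \<in> Lip_b Q dQ"
  shows "(\<lambda>x. u (\<pi> x)) \<in> Lip_b T d"
proof -
  obtain L where L: "L \<ge> 0" "\<And>A B. A \<in> topspace Q \<Longrightarrow> B \<in> topspace Q \<Longrightarrow>
      ennreal \<bar>u A - u B\<bar> \<le> ennreal L * dQ A B"
    using u by (auto simp: Lip_b_def)
  have "continuous_map T euclideanreal (\<lambda>x. u (\<pi> x))"
    using continuous_map_compose[OF continuous_map_quot_proj[OF cont_bounded], of euclideanreal u] u
    by (simp add: Lip_b_def o_def)
  moreover have "bounded ((\<lambda>x. u (\<pi> x)) ` X)"
    using u by (simp add: Lip_b_def topspace_Q image_image)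
  moreover have "ennreal \<bar>u (\<pi> x) - u (\<pi> y)\<bar> \<le> ennreal L * d x y" if "x \<in> X" "y \<in> X" for x y
  proof -
    have "ennreal \<bar>u (\<pi> x) - u (\<pi> y)\<bar> \<le> ennreal L * ennreal (\<delta> x y)"
      using L(2)[of "\<pi> x" "\<pi> y"] that by (simp add: topspace_Q dQ_proj)
    also have "\<dots> \<le> ennreal L * d x y"
      by (intro mult_left_mono le that) simp
    finally show ?thesis .
  qed
  ultimately show ?thesis
    using L(1) by (auto simp: Lip_b_def)
qed

text \<open>A competitor on the quotient, together with its bound, pulls back along the projection
  to a competitor at the same level. If \<open>f\<close> does not factor, the right side is
  infinite.\<close>

lemma Cheeger_le_Cheeger_semidist:
  assumes le: "\<And>x y. x \<in> X \<Longrightarrow> y \<in> X \<Longrightarrow> ennreal (\<delta> x y) \<le> d x y" and f: "f \<in> L2_set_of M"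
  shows "Cheeger T d M f \<le> Cheeger_semidist T \<delta> M f"
proof (cases "\<exists>g. g \<in> L2_set_of N \<and> (AE x in M. f x = g (\<pi> x))")
  case True
  \<comment> \<open>The same choice as in \<open>Cheeger_semidist\<close>, so that its definition
    unfolds to the energy of this \<open>g\<close>.\<close>
  define g where "g = (SOME g. g \<in> L2_set_of N \<and> (AE x in M. f x = g (\<pi> x)))"
  have g: "g \<in> L2_set_of N" "AE x in M. f x = g (\<pi> x)"
    using someI_ex[OF True] by (auto simp: g_def)
  have "Cheeger T d M f \<le> Cheeger Q dQ N g"
  proof (rule dense_ge)
    fix t assume t: "Cheeger Q dQ N g < t"
    show "Cheeger T d M f \<le> t"
    proof (rule Cheeger_leI[OF f])
      fix e :: real assume e: "e > 0"
      obtain u where u: "u \<in> L2_set_of N" "(\<integral>\<^sup>+x. ennreal ((u x - g x)\<^sup>2) \<partial>N) < ennreal e"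
          "Cheeger_competitor Q dQ N t u"
        by (rule Cheeger_lessE[OF t e])
      then obtain G where G: "G \<in> borel_measurable N" "AE A in N. Lip_a Q dQ u A \<le> G A"
          "(\<integral>\<^sup>+x. (G x)\<^sup>2 \<partial>N) \<le> t"
        by (auto simp: Cheeger_competitor_def)
      have [measurable]: "u \<in> borel_measurable N" "g \<in> borel_measurable N"
        using u g by (auto simp: L2_measurable)
      have "(\<integral>\<^sup>+x. ennreal ((u (\<pi> x) - f x)\<^sup>2) \<partial>M) = (\<integral>\<^sup>+x. ennreal ((u (\<pi> x) - g (\<pi> x))\<^sup>2) \<partial>M)"
        using g(2) by (intro nn_integral_cong_AE) auto
      also have "\<dots> = (\<integral>\<^sup>+x. ennreal ((u x - g x)\<^sup>2) \<partial>N)"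
        by (intro nn_integral_N[symmetric]) measurable
      finally have "(\<integral>\<^sup>+x. ennreal ((u (\<pi> x) - f x)\<^sup>2) \<partial>M) < ennreal e"
        using u(2) by simp
      moreover have "Cheeger_competitor T d M t (\<lambda>x. u (\<pi> x))"
        unfolding Cheeger_competitor_def
      proof (intro conjI bexI)
        show "(\<lambda>x. u (\<pi> x)) \<in> Lip_b T d"
          using u(3) by (intro Lip_b_comp_proj le) (auto simp: Cheeger_competitor_def)
        show "(\<lambda>x. G (\<pi> x)) \<in> borel_measurable M"
          by (rule measurable_compose[OF measurable_proj_N G(1)])
        show "AE x in M. Lip_a T d (\<lambda>x. u (\<pi> x)) x \<le> G (\<pi> x)"
          using AE_N_D[OF G(2)] AE_space
        proof eventually_elim
          case (elim x)
          then show ?case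
            using Lip_a_comp_proj_le[of d x u, OF le] by (auto simp: space_M)
        qed
        show "(\<integral>\<^sup>+x. (G (\<pi> x))\<^sup>2 \<partial>M) \<le> t"
          using G by (subst nn_integral_N[symmetric]) auto
      qed
      ultimately show "\<exists>u\<in>L2_set_of M. (\<integral>\<^sup>+x. ennreal ((u x - f x)\<^sup>2) \<partial>M) < ennreal e \<and>
          Cheeger_competitor T d M t u"
        using L2_comp_proj[OF u(1)] by (intro bexI[of _ "\<lambda>x. u (\<pi> x)"] conjI)
    qed
  qed
  with True show ?thesis
    by (simp add: Cheeger_semidist_def g_def)
next
  case False
  then show ?thesis
    unfolding Cheeger_semidist_def Let_def by (simp only: if_False) simp
qed

text \<open>\<open>Lip_a\<close> is upper semicontinuous for the quotient metric: if
  \<open>B\<close> is within \<open>r / 2\<close> of \<open>A\<close>, the ball of radius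
  \<open>r / 2\<close> about \<open>B\<close> lies in the ball of radius \<open>r\<close> about
  \<open>A\<close>. Hence \<open>Lip_a\<close> can itself serve as the bound of a
  competitor.\<close>

lemma Lip_a_quot_measurable: "Lip_a Q dQ V \<in> borel_measurable N"
proof (rule borel_measurableI_less)
  fix t
  have "openin Q {A \<in> topspace Q. Lip_a Q dQ V A < t}"
    unfolding quot_topology_def Q.openin_mtopology
  proof (intro conjI allI impI)
    fix A assume "A \<in> {A \<in> topspace Q.mtopology. Lip_a Q.mtopology dQ V A < t}"
    then have A: "A \<in> quot_space X \<delta>" "Lip_a Q.mtopology dQ V A < t" by auto
    then obtain r where r: "r > 0" "Lip_ball Q.mtopology dQ V A r < t"
      by (auto simp: Lip_a_eq_INF INF_less_iff)
    have "Lip_a Q.mtopology dQ V B < t" if B: "B \<in> Q.mball A (r / 2)" for B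
    proof -
      have near: "quot_dist X \<delta> C A < r" if "C \<in> quot_space X \<delta>" "quot_dist X \<delta> C B < r / 2" for C
        using that B Q.triangle[of C B A] Q.commute[of A B] by (auto simp: Q.in_mball)
      have "Lip_a Q.mtopology dQ V B \<le> Lip_ball Q.mtopology dQ V B (r / 2)"
        unfolding Lip_a_eq_INF using r(1) by (intro INF_lower) simp
      also have "\<dots> \<le> Lip_ball Q.mtopology dQ V A r"
        unfolding Lip_ball_def
      proof (rule Sup_subset_mono, safe)
        fix y z assume yz: "y \<in> topspace Q.mtopology" "z \<in> topspace Q.mtopology"
          "max (dQ y B) (dQ z B) < ennreal (r / 2)" "0 < dQ y z"
        then have "max (dQ y A) (dQ z A) < ennreal r"
          using near[of y] near[of z] by (simp add: ennreal_less_iff)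
        with yz show "\<exists>y' z'. ennreal \<bar>V y - V z\<bar> / dQ y z = ennreal \<bar>V y' - V z'\<bar> / dQ y' z' \<and>
            y' \<in> topspace Q.mtopology \<and> z' \<in> topspace Q.mtopology \<and>
            max (dQ y' A) (dQ z' A) < ennreal r \<and> 0 < dQ y' z'"
          by blast
      qed
      finally show ?thesis using r(2) by simp
    qed
    with r(1) show "\<exists>r>0. Q.mball A r \<subseteq> {A \<in> topspace Q.mtopology. Lip_a Q.mtopology dQ V A < t}"
      by (intro exI[of _ "r / 2"]) auto
  qed auto
  moreover have "{U. openin Q U} \<subseteq> Pow (topspace Q)"
    by (auto dest: openin_subset)
  ultimately show "{x \<in> space N. Lip_a Q dQ V x < t} \<in> sets N"
    by (simp add: sets_N space_N borel_of_topology_def sets_measure_of)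
qed

text \<open>A function that is Lipschitz for \<delta> descends to the quotient, where it is a
  competitor for its own energy with \<open>Lip_a\<close> as bound; the pointwise estimate
  \<open>c\<close> enters only through monotonicity of the integral.\<close>

lemma Cheeger_semidist_le:
  fixes v :: "'a \<Rightarrow> real" and c :: "'a \<Rightarrow> ennreal"
  assumes bound: "\<And>x. x \<in> X \<Longrightarrow> \<bar>v x\<bar> \<le> B"
    and L: "L \<ge> 0" and lip: "\<And>x y. x \<in> X \<Longrightarrow> y \<in> X \<Longrightarrow> \<bar>v x - v y\<bar> \<le> L * \<delta> x y"
    and loc: "\<And>x. x \<in> X \<Longrightarrow> \<exists>r>0. \<forall>y\<in>X. \<forall>z\<in>X. \<delta> y x < r \<longrightarrow> \<delta> z x < r \<longrightarrow>
      ennreal \<bar>v y - v z\<bar> \<le> c x * ennreal (\<delta> y z)"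
  shows "v \<in> L2_set_of M" "Cheeger_semidist T \<delta> M v \<le> (\<integral>\<^sup>+x. (c x)\<^sup>2 \<partial>M)"
proof -
  \<comment> \<open>\<open>v\<close> evaluated at a chosen representative; the Lipschitz bound makes
    the choice irrelevant.\<close>
  define V where "V A = v (SOME x. x \<in> X \<and> \<pi> x = A)" for A
  have V: "V (\<pi> x) = v x" if x: "x \<in> X" for x
  proof -
    define y where "y = (SOME y. y \<in> X \<and> \<pi> y = \<pi> x)"
    have y: "y \<in> X" "\<pi> y = \<pi> x"
      using someI[of "\<lambda>y. y \<in> X \<and> \<pi> y = \<pi> x" x] x by (auto simp: y_def)
    then have "\<delta> y x = 0"
      using x quot_proj_eq_iff[OF semidist] by blast
    then have "v y = v x"
      using lip[OF y(1) x] by simp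
    then show ?thesis by (simp add: V_def y_def)
  qed
  have VL: "\<bar>V A - V A'\<bar> \<le> L * quot_dist X \<delta> A A'" if "A \<in> quot_space X \<delta>" "A' \<in> quot_space X \<delta>" for A A'
    using that lip by (auto simp: quot_space_eq V quot_dist_proj[OF semidist])
  have "continuous_map Q.mtopology (Metric_space.mtopology UNIV dist) V"
    unfolding Q.metric_continuous_map[OF Met_TC.Metric_space_axioms]
  proof (intro conjI ballI allI impI)
    fix A and e :: real assume A: "A \<in> quot_space X \<delta>" and e: "e > 0"
    \<comment> \<open>\<open>L + 1\<close> instead of \<open>L\<close> avoids a division by zero for
      constant functions.\<close>
    have "dist (V A) (V A') < e" if "A' \<in> quot_space X \<delta> \<and> quot_dist X \<delta> A A' < e / (L + 1)" for A'
    proof -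
      have "(L + 1) * quot_dist X \<delta> A A' < e"
        using that L by (simp add: pos_less_divide_eq mult.commute)
      then show ?thesis
        using VL[of A A'] A that Q.nonneg[of A A']
        unfolding dist_real_def distrib_right by linarith
    qed
    then show "\<exists>r>0. \<forall>A'. A' \<in> quot_space X \<delta> \<and> quot_dist X \<delta> A A' < r \<longrightarrow> dist (V A) (V A') < e"
      using e L by (intro exI[of _ "e / (L + 1)"]) auto
  qed auto
  then have contV: "continuous_map Q euclideanreal V"
    by (simp add: quot_topology_def)
  have boundV: "\<bar>V A\<bar> \<le> B" if "A \<in> topspace Q" for A
    using that bound by (auto simp: topspace_Q V)
  have Lip_b_V: "V \<in> Lip_b Q dQ"
    unfolding Lip_b_def
  proof (intro CollectI conjI exI[of _ L] ballI)
    show "bounded (V ` topspace Q)"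
      using boundV by (auto simp: bounded_iff)
    fix A A' assume A: "A \<in> topspace Q" "A' \<in> topspace Q"
    then have "ennreal \<bar>V A - V A'\<bar> \<le> ennreal (L * quot_dist X \<delta> A A')"
      by (intro ennreal_leI VL) (simp_all add: quot_topology_def)
    then show "ennreal \<bar>V A - V A'\<bar> \<le> ennreal L * dQ A A'"
      by (simp add: ennreal_mult L)
  qed (use contV L in auto)
  have measV: "V \<in> borel_measurable N"
    by (rule continuous_map_borel_measurable[OF space_N sets_N contV])
  have L2V: "V \<in> L2_set_of N"
    by (rule bounded_measurable_L2[OF finite_measure_N measV, of B]) (simp add: boundV space_N)
  have "v \<in> borel_measurable M"
    using measurable_compose[OF measurable_proj_N measV]
    by (rule measurable_cong[THEN iffD1, rotated]) (simp add: space_M V)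
  then show "v \<in> L2_set_of M"
    by (intro bounded_measurable_L2[of M v B] prob_space.finite_measure prob_M)
      (auto simp: space_M bound)
  \<comment> \<open>\<open>Cheeger_semidist\<close> selects some factor \<open>g\<close>, possibly
    different from \<open>V\<close>. The two are at L2-distance zero on the quotient, so
    \<open>V\<close> is an admissible approximant of \<open>g\<close> at every precision.\<close>
  define g where "g = (SOME g. g \<in> L2_set_of N \<and> (AE x in M. v x = g (\<pi> x)))"
  have AEV: "AE x in M. v x = V (\<pi> x)"
    by (rule AE_I2) (simp add: space_M V)
  with L2V have ex: "\<exists>g. g \<in> L2_set_of N \<and> (AE x in M. v x = g (\<pi> x))"
    by blast
  then have g: "g \<in> L2_set_of N" "AE x in M. v x = g (\<pi> x)"
    using someI_ex[OF ex] by (auto simp: g_def)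
  have [measurable]: "g \<in> borel_measurable N" "V \<in> borel_measurable N"
    using g measV by (auto simp: L2_measurable)
  have "(\<integral>\<^sup>+x. ennreal ((V x - g x)\<^sup>2) \<partial>N) = (\<integral>\<^sup>+x. ennreal ((V (\<pi> x) - g (\<pi> x))\<^sup>2) \<partial>M)"
    by (rule nn_integral_N) measurable
  also have "\<dots> = (\<integral>\<^sup>+x. 0 \<partial>M)"
    using g(2) AEV by (intro nn_integral_cong_AE) auto
  finally have zero: "(\<integral>\<^sup>+x. ennreal ((V x - g x)\<^sup>2) \<partial>N) = 0"
    by simp
  have "(\<integral>\<^sup>+A. (Lip_a Q dQ V A)\<^sup>2 \<partial>N) = (\<integral>\<^sup>+x. (Lip_a Q dQ V (\<pi> x))\<^sup>2 \<partial>M)"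
    using Lip_a_quot_measurable by (intro nn_integral_N) measurable
  also have "\<dots> \<le> (\<integral>\<^sup>+x. (c x)\<^sup>2 \<partial>M)"
  proof (intro nn_integral_mono power_mono)
    fix x assume "x \<in> space M"
    then have x: "x \<in> X" by (simp add: space_M)
    obtain r where r: "r > 0" "\<And>y z. y \<in> X \<Longrightarrow> z \<in> X \<Longrightarrow> \<delta> y x < r \<Longrightarrow> \<delta> z x < r \<Longrightarrow>
        ennreal \<bar>v y - v z\<bar> \<le> c x * ennreal (\<delta> y z)"
      using loc[OF x] by blast
    show "Lip_a Q dQ V (\<pi> x) \<le> c x"
      by (rule Lip_a_leI[OF r(1)])
        (use r x in \<open>auto simp: topspace_Q V quot_dist_proj[OF semidist] ennreal_less_iff
          semidist[unfolded semidistance_on_def]\<close>)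
  qed simp
  finally have "Cheeger_competitor Q dQ N (\<integral>\<^sup>+x. (c x)\<^sup>2 \<partial>M) V"
    unfolding Cheeger_competitor_def using Lip_b_V Lip_a_quot_measurable by auto
  with L2V zero have "Cheeger Q dQ N g \<le> (\<integral>\<^sup>+x. (c x)\<^sup>2 \<partial>M)"
    by (intro Cheeger_leI[OF g(1)] bexI[of _ V]) auto
  with ex show "Cheeger_semidist T \<delta> M v \<le> (\<integral>\<^sup>+x. (c x)\<^sup>2 \<partial>M)"
    by (simp add: Cheeger_semidist_def g_def)
qed

end

section \<open>Gluing, directed families and compact sets\<close>

text \<open>The glued function is the truncation at height \<open>B\<close> of the infimum over \<open>k\<close> and \<open>y, y' \<in> K k\<close> of
  \<open>h y' + c k * \<delta> u y' + 4 * L * (\<delta> u y - s)\<^sup>+\<close>. The infimum over \<open>y'\<close> is the McShane extension of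
  \<open>h\<close> from \<open>K k\<close> with slope \<open>c k\<close>; the last term, minimised over \<open>y\<close>, vanishes up to distance \<open>s\<close>
  from \<open>K k\<close> and keeps the extensions from the other pieces from being active there.\<close>

lemma separated_Lipschitz_gluing:
  fixes X :: "'a set" and \<delta> :: "'a \<Rightarrow> 'a \<Rightarrow> real" and K :: "'k \<Rightarrow> 'a set" and c :: "'k \<Rightarrow> real"
  assumes \<delta>: "semidistance_on X \<delta>"
    and K: "\<And>k. k \<in> A \<Longrightarrow> K k \<subseteq> X" and ne: "\<exists>k\<in>A. K k \<noteq> {}"
    and c: "\<And>k. k \<in> A \<Longrightarrow> 0 \<le> c k \<and> c k \<le> L" and L: "L > 0" and s: "s > 0"
    and sep: "\<And>k l x y. k \<in> A \<Longrightarrow> l \<in> A \<Longrightarrow> k \<noteq> l \<Longrightarrow> x \<in> K k \<Longrightarrow> y \<in> K l \<Longrightarrow> 4 * s \<le> \<delta> x y"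
    and hB: "\<And>k x. k \<in> A \<Longrightarrow> x \<in> K k \<Longrightarrow> \<bar>h x\<bar> \<le> B"
    and hc: "\<And>k x y. k \<in> A \<Longrightarrow> x \<in> K k \<Longrightarrow> y \<in> K k \<Longrightarrow> h x - h y \<le> c k * \<delta> x y + e"
    and hL: "\<And>k l x y. k \<in> A \<Longrightarrow> l \<in> A \<Longrightarrow> x \<in> K k \<Longrightarrow> y \<in> K l \<Longrightarrow> h x - h y \<le> L * \<delta> x y + e"
    and e: "0 \<le> e" "2 * e \<le> L * s"
  obtains v where "\<And>u. \<bar>v u\<bar> \<le> B"
    "\<And>u w. u \<in> X \<Longrightarrow> w \<in> X \<Longrightarrow> \<bar>v u - v w\<bar> \<le> 5 * L * \<delta> u w"
    "\<And>k x. k \<in> A \<Longrightarrow> x \<in> K k \<Longrightarrow> \<bar>v x - h x\<bar> \<le> e"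
    "\<And>k x u w. k \<in> A \<Longrightarrow> x \<in> K k \<Longrightarrow> u \<in> X \<Longrightarrow> w \<in> X \<Longrightarrow> \<delta> u x < s / 2 \<Longrightarrow> \<delta> w x < s / 2 \<Longrightarrow>
       \<bar>v u - v w\<bar> \<le> c k * \<delta> u w"
proof -
  have nonneg: "\<And>x y. x \<in> X \<Longrightarrow> y \<in> X \<Longrightarrow> 0 \<le> \<delta> x y"
    and sym: "\<And>x y. x \<in> X \<Longrightarrow> y \<in> X \<Longrightarrow> \<delta> x y = \<delta> y x"
    and refl: "\<And>x. x \<in> X \<Longrightarrow> \<delta> x x = 0"
    and tri: "\<And>x y z. x \<in> X \<Longrightarrow> y \<in> X \<Longrightarrow> z \<in> X \<Longrightarrow> \<delta> x z \<le> \<delta> x y + \<delta> y z"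
    using \<delta> unfolding semidistance_on_def by blast+
  define P where "P = (SIGMA k:A. K k \<times> K k)"
  \<comment> \<open>The absolute value and the positive part keep every candidate above
    \<open>- B\<close>, also for \<open>u\<close> outside of \<open>X\<close>, where nothing is
    known about \<delta>. So the infimum is well behaved everywhere.\<close>
  define val where "val = (\<lambda>(k, y, y') u. min B (h y' + c k * \<bar>\<delta> u y'\<bar> + 4 * L * max 0 (\<delta> u y - s)))"
  define v where "v u = (INF p\<in>P. val p u)" for u
  have B: "0 \<le> B" using ne hB by force
  have Pne: "P \<noteq> {}" using ne by (auto simp: P_def)
  have lower: "- B \<le> val p u" if pP: "p \<in> P" for p u
  proof -
    obtain k y y' where p: "p = (k, y, y')" "k \<in> A" "y \<in> K k" "y' \<in> K k"
      using pP by (auto simp: P_def)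
    have "- B \<le> h y'" "0 \<le> c k * \<bar>\<delta> u y'\<bar>" "0 \<le> 4 * L * max 0 (\<delta> u y - s)"
      using hB[of k y'] p c[of k] L by (auto simp: abs_le_iff)
    then show ?thesis using B by (simp add: p val_def)
  qed
  have bdd: "bdd_below ((\<lambda>p. val p u) ` P)" for u
    using lower by (intro bdd_belowI[of _ "- B"]) auto
  have v_le: "v u \<le> val p u" if "p \<in> P" for p u
    unfolding v_def by (rule cINF_lower[OF bdd that])
  have v_ge: "m \<le> v u" if "\<And>p. p \<in> P \<Longrightarrow> m \<le> val p u" for m u
    unfolding v_def by (rule cINF_greatest[OF Pne that])
  have v_leB: "v u \<le> B" for u
  proof -
    obtain p where "p \<in> P" using Pne by blast
    from v_le[OF this, of u] show ?thesis by (auto simp: val_def split: prod.splits)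
  qed
  \<comment> \<open>Going from \<open>x\<close> through \<open>y\<close> to \<open>y'\<close> costs
    twice \<open>L * \<delta> u y\<close> plus multiples of \<open>L * s\<close>. Since
    \<open>u\<close> is at least \<open>7 / 2 * s\<close> away from \<open>y\<close>, the penalty of
    slope \<open>4 * L\<close> absorbs this and leaves the margin \<open>L * s / 2\<close>.\<close>
  have far: "h x + L * s / 2 \<le> h y' + c l * \<delta> u y' + 4 * L * max 0 (\<delta> u y - s)"
    if kl: "k \<in> A" "l \<in> A" "k \<noteq> l" and x: "x \<in> K k" and y: "y \<in> K l" "y' \<in> K l"
      and u: "u \<in> X" "\<delta> u x < s / 2" for k l x y y' u
  proof -
    have X: "x \<in> X" "y \<in> X" "y' \<in> X" using K kl x y by blast+
    have 1: "h y - h y' \<le> c l * \<delta> y y' + e" using hc kl y by blast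
    have 2: "h x - h y \<le> L * \<delta> x y + e" using hL kl x y by blast
    have "c l * \<delta> y y' \<le> c l * (\<delta> u y + \<delta> u y')"
      using tri[OF X(2) u(1) X(3)] sym[OF u(1) X(2)] c[OF kl(2)] by (intro mult_left_mono) auto
    also have "\<dots> \<le> L * \<delta> u y + c l * \<delta> u y'"
      using c[OF kl(2)] nonneg[OF u(1) X(2)] by (simp add: distrib_left mult_right_mono)
    finally have 3: "c l * \<delta> y y' \<le> L * \<delta> u y + c l * \<delta> u y'" .
    have "\<delta> x y \<le> s / 2 + \<delta> u y"
      using tri[OF X(1) u(1) X(2)] sym[OF u(1) X(1)] u(2) by linarith
    then have 4: "L * \<delta> x y \<le> L * (s / 2) + L * \<delta> u y"
      using L by (metis distrib_left less_imp_le mult_left_mono)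
    have "7 / 2 * s \<le> \<delta> u y"
      using sep[OF kl x y(1)] \<open>\<delta> x y \<le> s / 2 + \<delta> u y\<close> by linarith
    then have 5: "L * (7 / 2 * s) \<le> L * \<delta> u y"
      using L by (intro mult_left_mono) auto
    have "4 * L * (\<delta> u y - s) \<le> 4 * L * max 0 (\<delta> u y - s)"
      using L by (intro mult_left_mono) auto
    then have 6: "4 * (L * \<delta> u y) - 4 * (L * s) \<le> 4 * L * max 0 (\<delta> u y - s)"
      by (simp add: algebra_simps)
    have "L * s > 0" using L s by simp
    with 1 2 3 4 5 6 e(2) show ?thesis by (simp add: algebra_simps)
  qed
  \<comment> \<open>The triple with \<open>y = x\<close> carries no penalty, because
    \<open>u\<close> is closer to \<open>x\<close> than \<open>s\<close>.\<close>
  have near: "v u \<le> h y' + c k * \<delta> u y'" if "k \<in> A" "x \<in> K k" "y' \<in> K k" "u \<in> X" "\<delta> u x < s / 2" for k x y' u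
  proof -
    have "y' \<in> X" using that K by blast
    then have "val (k, x, y') u \<le> h y' + c k * \<delta> u y'"
      using that s nonneg[of u y'] by (simp add: val_def)
    moreover have "(k, x, y') \<in> P" using that by (simp add: P_def)
    ultimately show ?thesis using v_le order_trans by blast
  qed
  \<comment> \<open>The McShane term contributes slope \<open>L\<close>, the penalty
    \<open>4 * L\<close>.\<close>
  have val_lip: "val p u \<le> val p w + 5 * L * \<delta> u w" if pP: "p \<in> P" and uw: "u \<in> X" "w \<in> X" for p u w
  proof -
    obtain k y y' where p: "p = (k, y, y')" "k \<in> A" "y \<in> K k" "y' \<in> K k"
      using pP by (auto simp: P_def)
    have X: "y \<in> X" "y' \<in> X" using K p by blast+
    have "c k * \<delta> u y' \<le> c k * (\<delta> u w + \<delta> w y')"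
      using tri[OF uw X(2)] c[OF p(2)] by (intro mult_left_mono) auto
    also have "\<dots> \<le> L * \<delta> u w + c k * \<delta> w y'"
      using c[OF p(2)] nonneg[OF uw] by (simp add: distrib_left mult_right_mono)
    finally have 1: "c k * \<delta> u y' \<le> L * \<delta> u w + c k * \<delta> w y'" .
    have "max 0 (\<delta> u y - s) \<le> max 0 (\<delta> w y - s) + \<delta> u w"
      using tri[OF uw X(1)] nonneg[OF uw] by auto
    then have "4 * L * max 0 (\<delta> u y - s) \<le> 4 * L * (max 0 (\<delta> w y - s) + \<delta> u w)"
      using L by (intro mult_left_mono) auto
    then have 2: "4 * L * max 0 (\<delta> u y - s) \<le> 4 * L * max 0 (\<delta> w y - s) + 4 * (L * \<delta> u w)"
      by (simp add: distrib_left)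
    have "0 \<le> L * \<delta> u w" using L nonneg[OF uw] by simp
    with 1 2 nonneg[OF uw(1) X(2)] nonneg[OF uw(2) X(2)] show ?thesis
      by (auto simp: p val_def min_def)
  qed
  have half_lip: "v u \<le> v w + 5 * L * \<delta> u w" if "u \<in> X" "w \<in> X" for u w
  proof -
    have "v u - 5 * L * \<delta> u w \<le> v w"
    proof (rule v_ge)
      fix p assume "p \<in> P"
      with v_le[of p u] val_lip[of p u w] that show "v u - 5 * L * \<delta> u w \<le> val p w" by simp
    qed
    then show ?thesis by simp
  qed
  have half_loc: "v u \<le> v w + c k * \<delta> u w"
    if k: "k \<in> A" "x \<in> K k" and uw: "u \<in> X" "w \<in> X" "\<delta> u x < s / 2" "\<delta> w x < s / 2" for k x u w
  proof -
    have x: "x \<in> X" using K k by blast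
    have "v u - c k * \<delta> u w \<le> v w"
    proof (rule v_ge)
      fix p assume "p \<in> P"
      then obtain l y y' where p: "p = (l, y, y')" "l \<in> A" "y \<in> K l" "y' \<in> K l"
        by (auto simp: P_def)
      have y': "y' \<in> X" using K p by blast
      have ckuw: "0 \<le> c k * \<delta> u w" using c[OF k(1)] nonneg[OF uw(1,2)] by simp
      have "v u - c k * \<delta> u w \<le> h y' + c l * \<delta> w y' + 4 * L * max 0 (\<delta> w y - s)"
      \<comment> \<open>Candidates from the same piece are compared at equal \<open>y'\<close> and
        have slope \<open>c k\<close>. Those from other pieces lie above
        \<open>h x + L * s / 2\<close> by \<open>far\<close>, while \<open>near\<close> keeps
        \<open>v u\<close> below that value.\<close>
      proof (cases "l = k")
        case True
        have "c k * \<delta> u y' \<le> c k * (\<delta> u w + \<delta> w y')"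
          using tri[OF uw(1,2) y'] c[OF k(1)] by (intro mult_left_mono) auto
        moreover have "v u \<le> h y' + c k * \<delta> u y'"
          using near[OF k, of y' u] uw p True by simp
        moreover have "0 \<le> 4 * L * max 0 (\<delta> w y - s)" using L by simp
        ultimately show ?thesis using True by (simp add: distrib_left)
      next
        case False
        have "v u \<le> h x + c k * \<delta> u x"
          using near[OF k k(2)] uw by blast
        also have "c k * \<delta> u x \<le> L * (s / 2)"
          using c[OF k(1)] uw nonneg[OF uw(1) x] L by (intro mult_mono) auto
        finally have "v u \<le> h x + L * s / 2" by simp
        also have "\<dots> \<le> h y' + c l * \<delta> w y' + 4 * L * max 0 (\<delta> w y - s)"
          by (rule far) (use False k p uw in auto)
        finally show ?thesis using ckuw by linarith
      qed
      moreover have "v u - c k * \<delta> u w \<le> B"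
        using v_leB[of u] ckuw by linarith
      ultimately show "v u - c k * \<delta> u w \<le> val p w"
        using nonneg[OF uw(2) y'] by (simp add: p val_def)
    qed
    then show ?thesis by simp
  qed
  show thesis
  proof (rule that[of v])
    show "\<bar>v u\<bar> \<le> B" for u
      using v_leB[of u] v_ge[OF lower, of u] by (simp add: abs_le_iff)
    show "\<bar>v u - v w\<bar> \<le> 5 * L * \<delta> u w" if "u \<in> X" "w \<in> X" for u w
      using half_lip[of u w] half_lip[of w u] that sym[of u w] by (simp add: abs_le_iff)
    show "\<bar>v u - v w\<bar> \<le> c k * \<delta> u w"
      if "k \<in> A" "x \<in> K k" "u \<in> X" "w \<in> X" "\<delta> u x < s / 2" "\<delta> w x < s / 2" for k x u w
      using half_loc[of k x u w] half_loc[of k x w u] that sym[of u w] by (simp add: abs_le_iff)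
    show "\<bar>v x - h x\<bar> \<le> e" if k: "k \<in> A" "x \<in> K k" for k x
    proof -
      have x: "x \<in> X" using K k by blast
      have "v x \<le> h x"
        using near[OF k k(2) x] refl[OF x] s by simp
      moreover have "h x - e \<le> v x"
      proof (rule v_ge)
        fix p assume "p \<in> P"
        then obtain l y y' where p: "p = (l, y, y')" "l \<in> A" "y \<in> K l" "y' \<in> K l"
          by (auto simp: P_def)
        have y': "y' \<in> X" using K p by blast
        have "h x - e \<le> h y' + c l * \<delta> x y' + 4 * L * max 0 (\<delta> x y - s)"
        proof (cases "l = k")
          case True
          moreover have "0 \<le> 4 * L * max 0 (\<delta> x y - s)" using L by simp
          ultimately show ?thesis using hc[of k x y'] p k by simp
        next
          case False
          have "h x + L * s / 2 \<le> h y' + c l * \<delta> x y' + 4 * L * max 0 (\<delta> x y - s)"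
            by (rule far) (use False k p x refl s in auto)
          moreover have "0 \<le> L * s / 2" using L s by simp
          ultimately show ?thesis using e(1) by linarith
        qed
        moreover have "h x - e \<le> B" using hB[OF k] e(1) by (simp add: abs_le_iff)
        ultimately show "h x - e \<le> val p x"
          using nonneg[OF x y'] by (simp add: p val_def)
      qed
      ultimately show ?thesis using e(1) by (simp add: abs_le_iff)
    qed
  qed
qed

section \<open>Directed index sets and compactness\<close>

lemma directed_finite_upper_bound:
  assumes dir: "directed_set I le" and J: "finite J" "J \<subseteq> I"
  shows "\<exists>k\<in>I. \<forall>j\<in>J. le j k"
proof -
  have ne: "I \<noteq> {}" and ub: "\<And>i j. i \<in> I \<Longrightarrow> j \<in> I \<Longrightarrow> \<exists>k\<in>I. le i k \<and> le j k"
    and tr: "\<And>i j k. i \<in> I \<Longrightarrow> j \<in> I \<Longrightarrow> k \<in> I \<Longrightarrow> le i j \<Longrightarrow> le j k \<Longrightarrow> le i k"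
    using dir unfolding directed_set_def by (blast, blast, meson)
  from J show ?thesis
  proof (induction J rule: finite_induct)
    case empty
    then show ?case using ne by auto
  next
    case (insert a J)
    then obtain k where k: "k \<in> I" "\<forall>j\<in>J. le j k" by auto
    obtain k' where k': "k' \<in> I" "le a k'" "le k k'"
      using ub[of a k] k(1) insert.prems by auto
    have "le j k'" if "j \<in> J" for j
      using tr[of j k k'] k k' insert.prems that by blast
    with k' show ?case by blast
  qed
qed

lemma directed_eventually_ball_finite:
  assumes dir: "directed_set I le" and A: "finite A"
    and ev: "\<And>a. a \<in> A \<Longrightarrow> \<exists>i\<in>I. \<forall>j\<in>I. le i j \<longrightarrow> P a j"
  shows "\<exists>i\<in>I. \<forall>j\<in>I. le i j \<longrightarrow> (\<forall>a\<in>A. P a j)"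
proof -
  obtain f where f: "\<And>a. a \<in> A \<Longrightarrow> f a \<in> I" "\<And>a j. a \<in> A \<Longrightarrow> j \<in> I \<Longrightarrow> le (f a) j \<Longrightarrow> P a j"
    using ev by metis
  obtain i where i: "i \<in> I" "\<forall>a\<in>A. le (f a) i"
    using directed_finite_upper_bound[OF dir, of "f ` A"] A f(1) by auto
  have "P a j" if "j \<in> I" "le i j" "a \<in> A" for a j
  proof -
    have "le (f a) j"
      using dir i f(1)[OF that(3)] that unfolding directed_set_def by meson
    then show ?thesis using f(2) that by blast
  qed
  with i(1) show ?thesis by blast
qed

text \<open>Dini's argument: the open sets where some function of the family is positive cover
  \<open>C\<close>; an upper bound of the indices of a finite subcover works by
  monotonicity.\<close>

lemma directed_eventually_pos_on_compact:
  fixes \<phi> :: "'i \<Rightarrow> 'b \<Rightarrow> real"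
  assumes dir: "directed_set I le" and C: "compactin Z C"
    and cont: "\<And>i. i \<in> I \<Longrightarrow> continuous_map Z euclideanreal (\<phi> i)"
    and mono: "\<And>i j z. i \<in> I \<Longrightarrow> j \<in> I \<Longrightarrow> le i j \<Longrightarrow> z \<in> C \<Longrightarrow> \<phi> i z \<le> \<phi> j z"
    and pos: "\<And>z. z \<in> C \<Longrightarrow> \<exists>i\<in>I. 0 < \<phi> i z"
  shows "\<exists>i\<in>I. \<forall>j\<in>I. le i j \<longrightarrow> (\<forall>z\<in>C. 0 < \<phi> j z)"
proof -
  define U where "U i = {z \<in> topspace Z. \<phi> i z \<in> {0<..}}" for i
  have open_U: "openin Z (U i)" if "i \<in> I" for i
    unfolding U_def by (rule openin_continuous_map_preimage[OF cont[OF that]]) simp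
  have "C \<subseteq> \<Union> (U ` I)"
    using pos compactin_subset_topspace[OF C] by (fastforce simp: U_def)
  then obtain J where J: "finite J" "J \<subseteq> I" "C \<subseteq> \<Union> (U ` J)"
    using C open_U unfolding compactin_def by (metis (no_types, opaque_lifting) finite_subset_image imageE)
  obtain i where i: "i \<in> I" "\<forall>j\<in>J. le j i"
    using directed_finite_upper_bound[OF dir J(1,2)] by blast
  have "0 < \<phi> j z" if j: "j \<in> I" "le i j" and z: "z \<in> C" for j z
  proof -
    obtain k where k: "k \<in> J" "0 < \<phi> k z"
      using J(3) z by (auto simp: U_def)
    have "\<phi> k z \<le> \<phi> i z" "\<phi> i z \<le> \<phi> j z"
      using mono i J(2) k(1) j z by blast+
    with k(2) show ?thesis by linarith
  qed
  with i(1) show ?thesis by blast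
qed

lemma compactin_pos_lower_bound:
  fixes f :: "'b \<Rightarrow> real"
  assumes "compactin Z C" "continuous_map Z euclideanreal f" "\<And>z. z \<in> C \<Longrightarrow> 0 < f z"
  shows "\<exists>s>0. \<forall>z\<in>C. s \<le> f z"
proof (cases "C = {}")
  case False
  have "compact (f ` C)"
    using image_compactin[OF assms(1,2)] by (simp add: compactin_euclidean_iff)
  then obtain s where "s \<in> f ` C" "\<forall>t\<in>f ` C. s \<le> t"
    using compact_attains_inf[of "f ` C"] False by auto
  with assms(3) show ?thesis by auto
qed (auto intro: exI[of _ 1])

section \<open>Inner regularity by compact sets\<close>

lemma radon_prob_measureD:
  assumes "radon_prob_measure T M"
  shows "prob_space M" "space M = topspace T" "sets M = sets (borel_of_topology T)"
    "B \<in> sets M \<Longrightarrow> emeasure M B = (SUP K\<in>{K. compactin T K \<and> K \<subseteq> B}. emeasure M K)"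
  using assms unfolding radon_prob_measure_def by blast+

lemma radon_compact_measurable:
  assumes M: "radon_prob_measure T M" and haus: "Hausdorff_space T" and K: "compactin T K"
  shows "K \<in> sets M"
proof -
  have "closedin T K"
    by (rule compactin_imp_closedin[OF haus K])
  then have "openin T (topspace T - K)" "K \<subseteq> topspace T"
    by (auto simp: closedin_def)
  moreover have "{U. openin T U} \<subseteq> Pow (topspace T)"
    by (auto dest: openin_subset)
  ultimately have "space M - K \<in> sets M"
    by (simp add: radon_prob_measureD(2,3)[OF M] borel_of_topology_def sets_measure_of)
  then have "space M - (space M - K) \<in> sets M"
    by (rule sets.compl_sets)
  moreover have "space M - (space M - K) = K"
    using radon_prob_measureD(2)[OF M] \<open>K \<subseteq> topspace T\<close> by auto
  ultimately show ?thesis by simp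
qed

lemma radon_inner_compact:
  assumes M: "radon_prob_measure T M" and B: "B \<in> sets M" and e: "e > 0"
  obtains K where "compactin T K" "K \<subseteq> B" "measure M B - e < measure M K"
proof -
  interpret prob_space M by (rule radon_prob_measureD(1)[OF M])
  have "\<exists>K. compactin T K \<and> K \<subseteq> B \<and> measure M B - e < measure M K"
  proof (rule ccontr)
    assume "\<not> ?thesis"
    then have le: "measure M K \<le> measure M B - e" if "compactin T K" "K \<subseteq> B" for K
      using that by (meson not_le)
    have "emeasure M B = (SUP K\<in>{K. compactin T K \<and> K \<subseteq> B}. emeasure M K)"
      by (rule radon_prob_measureD(4)[OF M B])
    also have "\<dots> \<le> ennreal (measure M B - e)"
      using le by (intro SUP_least) (auto simp: emeasure_eq_measure intro: ennreal_leI)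
    finally have "measure M B \<le> measure M B - e \<or> measure M B \<le> 0"
      by (auto simp: emeasure_eq_measure ennreal_le_iff2)
    \<comment> \<open>\<open>ennreal\<close> truncates negative numbers to 0; the empty compact set
      shows that \<open>measure M B - e\<close> is not negative.\<close>
    moreover have "measure M {} \<le> measure M B - e"
      by (rule le) auto
    ultimately show False using e by simp
  qed
  then show thesis using that by blast
qed

text \<open>Make the cover disjoint, drop a tail of total mass below \<open>e / 2\<close>, and
  exhaust each remaining set from inside by a compact set, losing at most \<open>e / 2\<close>
  altogether.\<close>

lemma radon_finite_compact_cover:
  assumes M: "radon_prob_measure T M" and haus: "Hausdorff_space T"
    and B: "\<And>n::nat. B n \<in> sets M" and Y: "Y \<in> sets M" "Y \<subseteq> (\<Union>n. B n)" and e: "e > 0"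
  obtains N K where "\<And>n. compactin T (K n)" "\<And>n. K n \<subseteq> B n" "disjoint_family K"
    "measure M (Y - (\<Union>n<N. K n)) < e"
proof -
  interpret prob_space M by (rule radon_prob_measureD(1)[OF M])
  define D where "D = disjointed (\<lambda>n. B n \<inter> Y)"
  have DM[measurable]: "D n \<in> sets M" for n
    using sets.range_disjointed_sets[of "\<lambda>n. B n \<inter> Y" M] B Y(1) by (auto simp: D_def)
  have DB: "D n \<subseteq> B n" for n
    using disjointed_subset[of "\<lambda>n. B n \<inter> Y" n] by (auto simp: D_def)
  have D_disj: "disjoint_family D"
    by (simp add: D_def disjoint_family_disjointed)
  have UD: "(\<Union>n. D n) = Y"
    using Y(2) by (auto simp: D_def UN_disjointed_eq)
  have "(\<lambda>n. measure M (D n)) sums measure M (\<Union>n. D n)"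
    by (rule finite_measure_UNION) (use D_disj in auto)
  then have "(\<lambda>N. \<Sum>n<N. measure M (D n)) \<longlonglongrightarrow> measure M Y"
    by (simp add: sums_def UD)
  then have "\<forall>\<^sub>F N in sequentially. measure M Y - e / 2 < (\<Sum>n<N. measure M (D n))"
    by (rule order_tendstoD) (use e in simp)
  then obtain N where N: "measure M Y - e / 2 < (\<Sum>n<N. measure M (D n))"
    using eventually_happens'[OF sequentially_bot] by blast
  \<comment> \<open>\<open>N\<close> losses of this size add up to at most \<open>e / 2\<close>;
    \<open>Suc N\<close> covers the case \<open>N = 0\<close>.\<close>
  define \<eta> where "\<eta> = e / (2 * real (Suc N))"
  have \<eta>: "\<eta> > 0" "real N * \<eta> \<le> e / 2"
    using e by (auto simp: \<eta>_def field_simps)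
  have "\<exists>K. compactin T K \<and> K \<subseteq> D n \<and> measure M (D n) - \<eta> < measure M K" for n
    using radon_inner_compact[OF M DM \<eta>(1)] by metis
  then obtain K where K: "\<And>n. compactin T (K n)" "\<And>n. K n \<subseteq> D n"
      "\<And>n. measure M (D n) - \<eta> < measure M (K n)"
    by metis
  have KM[measurable]: "K n \<in> sets M" for n
    by (rule radon_compact_measurable[OF M haus K(1)])
  have K_disj: "disjoint_family K"
    using D_disj K(2) unfolding disjoint_family_on_def by blast
  have "(\<Sum>n<N. measure M (K n)) = measure M (\<Union>n<N. K n)"
    by (rule finite_measure_finite_Union[symmetric]) (use K_disj in \<open>auto simp: disjoint_family_on_def\<close>)
  moreover have "(\<Sum>n<N. measure M (D n)) - real N * \<eta> \<le> (\<Sum>n<N. measure M (K n))"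
  proof -
    have "(\<Sum>n<N. measure M (D n) - \<eta>) \<le> (\<Sum>n<N. measure M (K n))"
      using K(3) by (intro sum_mono less_imp_le)
    then show ?thesis by (simp add: sum_subtractf)
  qed
  moreover have "measure M (Y - (\<Union>n<N. K n)) = measure M Y - measure M (\<Union>n<N. K n)"
    using K(2) UD Y(1) by (intro finite_measure_Diff) auto
  ultimately have "measure M (Y - (\<Union>n<N. K n)) < e"
    using N \<eta>(2) by linarith
  then show thesis
    using that[of K N] K(1,2) DB K_disj by blast
qed

section \<open>Approximation of Lipschitz functions\<close>

text \<open>The cross term is absorbed by \<open>2 * r <= r^2 + 1\<close>, so adding
  \<open>e\<close> costs a factor close to 1 and a small constant.\<close>

lemma ennreal_square_add_le:
  fixes g :: ennreal
  assumes e: "e \<ge> 0"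
  shows "(g + ennreal e)\<^sup>2 \<le> ennreal (1 + e) * g\<^sup>2 + ennreal (e + e\<^sup>2)"
proof (cases g)
  case (real r)
  have "2 * r * e \<le> e * r\<^sup>2 + e"
    using mult_left_mono[OF zero_le_power2[of "r - 1"] e] by (simp add: power2_eq_square algebra_simps)
  then have "(r + e)\<^sup>2 \<le> (1 + e) * r\<^sup>2 + (e + e\<^sup>2)"
    by (simp add: power2_eq_square algebra_simps)
  then have "ennreal ((r + e)\<^sup>2) \<le> ennreal ((1 + e) * r\<^sup>2 + (e + e\<^sup>2))"
    by (rule ennreal_leI)
  with real e show ?thesis
    by (simp add: ennreal_plus ennreal_mult ennreal_power[symmetric] del: ennreal_plus[symmetric])
next
  case top
  have "ennreal (1 + e) * top\<^sup>2 = top"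
    using e by (simp add: power2_eq_square ennreal_mult_top)
  with top show ?thesis by simp
qed

section \<open>Monotone families of semidistances with supremum \<open>d\<close>\<close>

locale monotone_semidistances =
  fixes T :: "'a topology" and d :: "'a \<Rightarrow> 'a \<Rightarrow> ennreal" and M :: "'a measure"
    and I :: "'i set" and le :: "'i \<Rightarrow> 'i \<Rightarrow> bool" and ds :: "'i \<Rightarrow> 'a \<Rightarrow> 'a \<Rightarrow> real"
  assumes emt: "extended_metric_topological_space T d"
    and radon: "radon_prob_measure T M"
    and dir: "directed_set I le"
    and ds: "\<And>i. i \<in> I \<Longrightarrow> cont_bounded_semidistance T (ds i)"
    and ds_mono: "\<And>i j x y. i \<in> I \<Longrightarrow> j \<in> I \<Longrightarrow> le i j \<Longrightarrow> x \<in> topspace T \<Longrightarrow> y \<in> topspace T \<Longrightarrow>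
           ds i x y \<le> ds j x y"
    and d_SUP: "\<And>x y. x \<in> topspace T \<Longrightarrow> y \<in> topspace T \<Longrightarrow> d x y = (SUP i\<in>I. ennreal (ds i x y))"
begin

abbreviation "X \<equiv> topspace T"

lemma haus: "Hausdorff_space T"
  using emt unfolding extended_metric_topological_space_def by (rule conjunct1)

lemma emetric: "extended_metric_on X d"
  using emt unfolding extended_metric_topological_space_def by (rule conjunct1[OF conjunct2])

lemma d_sym: "x \<in> X \<Longrightarrow> y \<in> X \<Longrightarrow> d x y = d y x"
  and d_eq_0_iff: "x \<in> X \<Longrightarrow> y \<in> X \<Longrightarrow> d x y = 0 \<longleftrightarrow> x = y"
  using emetric unfolding extended_metric_on_def by blast+

lemma I_nonempty: "I \<noteq> {}"
  using dir by (simp add: directed_set_def)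

lemma ds_nonneg: "i \<in> I \<Longrightarrow> x \<in> X \<Longrightarrow> y \<in> X \<Longrightarrow> 0 \<le> ds i x y"
  using ds unfolding cont_bounded_semidistance_def semidistance_on_def by blast

lemma ds_le_d: "i \<in> I \<Longrightarrow> x \<in> X \<Longrightarrow> y \<in> X \<Longrightarrow> ennreal (ds i x y) \<le> d x y"
  unfolding d_SUP by (rule SUP_upper)

text \<open>A uniform bound on all \<open>ds i\<close> passes to \<open>d\<close>. Its
  nonnegativity, from a member of the nonempty family, is recorded because \<open>ennreal a\<close>
  hides the sign of \<open>a\<close>.\<close>

lemma d_leI:
  assumes xy: "x \<in> X" "y \<in> X" and a: "\<And>i. i \<in> I \<Longrightarrow> ds i x y \<le> a"
  shows "0 \<le> a" "d x y \<le> ennreal a"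
proof -
  obtain i where "i \<in> I" using I_nonempty by blast
  with ds_nonneg[OF this xy] a[of i] show "0 \<le> a" by simp
  show "d x y \<le> ennreal a"
    using xy a by (auto simp: d_SUP intro!: SUP_least ennreal_leI)
qed

lemma ds_continuous:
  "i \<in> I \<Longrightarrow> continuous_map (prod_topology T T) euclideanreal (\<lambda>p. ds i (fst p) (snd p))"
  using ds by (auto simp: cont_bounded_semidistance_def case_prod_beta')

text \<open>The complement of the set below within \<open>K\<close> is \<open>\<sigma>\<close>-compact, being the projection of
  a \<open>\<sigma>\<close>-compact subset of \<open>K \<times> K\<close>: \<open>d\<close> is lower semicontinuous.\<close>

lemma local_Lipschitz_set_measurable:
  assumes K: "compactin T K" and h: "continuous_map T euclideanreal h" and c: "c > 0" and r: "r > 0"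
  shows "{x \<in> K. \<forall>y\<in>K. d x y < ennreal r \<longrightarrow> ennreal \<bar>h x - h y\<bar> \<le> ennreal c * d x y} \<in> sets M"
    (is "?A \<in> _")
proof -
  let ?TT = "prod_topology T T"
  have KX: "K \<subseteq> X" by (rule compactin_subset_topspace[OF K])
  define \<epsilon> where "\<epsilon> m = inverse (real (Suc m))" for m
  \<comment> \<open>The strict inequalities \<open>d x y < r\<close> and
    \<open>c * d x y < |h x - h y|\<close> are exhausted by closed ones with gap
    \<open>\<epsilon> m\<close>, stated for all \<open>ds i\<close> because \<open>d\<close> is
    their supremum. This gives closed sets although \<open>d\<close> need not be continuous.\<close>
  define C where "C m = (\<Inter>i\<in>I. {p \<in> topspace ?TT. r - \<epsilon> m - ds i (fst p) (snd p) \<in> {0..}} \<inter>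
      {p \<in> topspace ?TT. \<bar>h (fst p) - h (snd p)\<bar> - \<epsilon> m - c * ds i (fst p) (snd p) \<in> {0..}})" for m
  have closedC: "closedin ?TT (C m)" for m
    unfolding C_def
  proof (intro closedin_INT I_nonempty closedin_Int)
    fix i assume i: "i \<in> I"
    have h1: "continuous_map ?TT euclideanreal (\<lambda>p. h (fst p))" "continuous_map ?TT euclideanreal (\<lambda>p. h (snd p))"
      using continuous_map_compose[OF continuous_map_fst h] continuous_map_compose[OF continuous_map_snd h]
      by (simp_all add: o_def)
    show "closedin ?TT {p \<in> topspace ?TT. r - \<epsilon> m - ds i (fst p) (snd p) \<in> {0..}}"
      by (rule closedin_continuous_map_preimage[where Y = euclideanreal])
        (auto intro!: continuous_map_diff ds_continuous i)
    show "closedin ?TT {p \<in> topspace ?TT. \<bar>h (fst p) - h (snd p)\<bar> - \<epsilon> m - c * ds i (fst p) (snd p) \<in> {0..}}"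
      by (rule closedin_continuous_map_preimage[where Y = euclideanreal])
        (auto intro!: continuous_map_diff continuous_map_real_abs continuous_map_real_mult_left ds_continuous i h1)
  qed
  have comp: "compactin T (fst ` (C m \<inter> (K \<times> K)))" for m
    by (intro image_compactin[OF _ continuous_map_fst[of T T]] closed_Int_compactin[OF closedC])
      (simp add: compactin_Times K)
  have "K - ?A = (\<Union>m. fst ` (C m \<inter> (K \<times> K)))"
  proof (intro set_eqI iffI)
    fix x assume "x \<in> K - ?A"
    then obtain y where xy: "x \<in> K" "y \<in> K" "d x y < ennreal r" "ennreal c * d x y < ennreal \<bar>h x - h y\<bar>"
      by (auto simp: not_le)
    have X: "x \<in> X" "y \<in> X" using xy KX by auto
    define D where "D = enn2real (d x y)"
    have D: "d x y = ennreal D" "0 \<le> D"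
      using xy(3) by (auto simp: D_def less_top[symmetric] top_unique dest: less_trans[OF _ ennreal_less_top])
    have "D < r" "c * D < \<bar>h x - h y\<bar>"
      using xy(3,4) D c by (auto simp: ennreal_less_iff ennreal_mult[symmetric])
    then obtain m where m: "\<epsilon> m < min (r - D) (\<bar>h x - h y\<bar> - c * D)"
      unfolding \<epsilon>_def using reals_Archimedean[of "min (r - D) (\<bar>h x - h y\<bar> - c * D)"] by auto
    have "ds i x y \<le> D" "c * ds i x y \<le> c * D" if "i \<in> I" for i
      using ds_le_d[OF that X] c D by (auto simp: ennreal_le_iff)
    then have "(x, y) \<in> C m \<inter> K \<times> K"
      using m X xy I_nonempty by (fastforce simp: C_def)
    then show "x \<in> (\<Union>m. fst ` (C m \<inter> (K \<times> K)))"
      by force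
  next
    fix x assume "x \<in> (\<Union>m. fst ` (C m \<inter> (K \<times> K)))"
    then obtain m y where xy: "x \<in> K" "y \<in> K" "(x, y) \<in> C m" by auto
    have X: "x \<in> X" "y \<in> X" using xy KX by auto
    have \<epsilon>: "\<epsilon> m > 0" by (simp add: \<epsilon>_def)
    have 1: "ds i x y \<le> r - \<epsilon> m" and 2: "c * ds i x y \<le> \<bar>h x - h y\<bar> - \<epsilon> m" if "i \<in> I" for i
      using xy(3) that by (auto simp: C_def)
    have "d x y \<le> ennreal (r - \<epsilon> m)"
      by (rule d_leI(2)[OF X 1])
    also have "\<dots> < ennreal r"
      using \<epsilon> r by (intro ennreal_lessI) auto
    finally have dr: "d x y < ennreal r" .
    have 3: "ds i x y \<le> (\<bar>h x - h y\<bar> - \<epsilon> m) / c" if "i \<in> I" for i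
      using 2[OF that] c by (simp add: pos_le_divide_eq mult.commute)
    have "ennreal c * d x y \<le> ennreal c * ennreal ((\<bar>h x - h y\<bar> - \<epsilon> m) / c)"
      by (intro mult_left_mono d_leI(2)[OF X 3]) simp_all
    also have "\<dots> = ennreal (\<bar>h x - h y\<bar> - \<epsilon> m)"
      using d_leI(1)[OF X 3] c by (simp add: ennreal_mult[symmetric])
    also have "\<dots> < ennreal \<bar>h x - h y\<bar>"
      using \<epsilon> d_leI(1)[OF X 3] c by (intro ennreal_lessI) (auto simp: zero_le_divide_iff)
    finally show "x \<in> K - ?A"
      using dr xy(1,2) by (auto simp: not_le)
  qed
  moreover have "(\<Union>m. fst ` (C m \<inter> (K \<times> K))) \<in> sets M"
    using radon_compact_measurable[OF radon haus comp] by (intro sets.countable_UN) auto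
  ultimately have "K - ?A \<in> sets M"
    by (simp only:)
  with radon_compact_measurable[OF radon haus K] have "K - (K - ?A) \<in> sets M"
    by (rule sets.Diff)
  also have "K - (K - ?A) = ?A" by (rule double_diff) auto
  finally show ?thesis .
qed

text \<open>The bound of \<open>c n\<close> by \<open>g + e\<close> makes slope \<open>c n\<close>
  affordable on its cell; the common bound \<open>L\<close> is independent of how many cells are
  used.\<close>

definition Lipschitz_cells ::
    "('a \<Rightarrow> real) \<Rightarrow> ('a \<Rightarrow> ennreal) \<Rightarrow> real \<Rightarrow> (nat \<Rightarrow> 'a set) \<Rightarrow> (nat \<Rightarrow> real) \<Rightarrow> real \<Rightarrow> bool" where
  "Lipschitz_cells h g e K c L \<longleftrightarrow> disjoint_family K \<and>
     (\<forall>n. compactin T (K n) \<and> 0 \<le> c n \<and> c n \<le> L \<and>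
       (\<forall>x\<in>K n. ennreal (c n) \<le> g x + ennreal e \<and>
         (\<forall>y\<in>K n. ennreal \<bar>h x - h y\<bar> \<le> ennreal (c n) * d x y)))"

text \<open>A set on which \<open>h\<close> is \<open>c\<close>-Lipschitz at scale \<open>\<rho>\<close> is cut along level sets of \<open>h\<close> of height
  \<open>c * \<rho>\<close>: on each slice \<open>h\<close> is \<open>c\<close>-Lipschitz at every scale.\<close>

lemma Lipschitz_partition:
  assumes h: "continuous_map T euclideanreal h"
    and L0: "L0 \<ge> 0" "\<And>x y. x \<in> X \<Longrightarrow> y \<in> X \<Longrightarrow> ennreal \<bar>h x - h y\<bar> \<le> ennreal L0 * d x y"
    and g[measurable]: "g \<in> borel_measurable M" and AE_g: "AE x in M. Lip_a T d h x \<le> g x"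
    and e: "e > 0"
  obtains N :: nat and K c L where "Lipschitz_cells h g e K c L" "L > 0" "L0 \<le> L" "L \<le> L0 + 2 * e"
    "measure M (X - (\<Union>n<N. K n)) < e"
proof -
  interpret prob_space M by (rule radon_prob_measureD(1)[OF radon])
  have space_M: "space M = X" by (rule radon_prob_measureD(2)[OF radon])
  have [measurable]: "h \<in> borel_measurable M"
    by (rule continuous_map_borel_measurable[OF space_M radon_prob_measureD(3)[OF radon] h])
  obtain Z where Z: "{x \<in> space M. \<not> Lip_a T d h x \<le> g x} \<subseteq> Z" "emeasure M Z = 0" "Z \<in> sets M"
    using AE_E[OF AE_g] by blast
  obtain K0 where K0: "compactin T K0" "K0 \<subseteq> X - Z" "measure M (X - Z) - e / 2 < measure M K0"
  proof (rule radon_inner_compact[OF radon, of "X - Z" "e / 2"])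
    show "X - Z \<in> sets M" using sets.compl_sets[OF Z(3)] by (simp add: space_M)
  qed (use e in auto)
  have K0M[measurable]: "K0 \<in> sets M" by (rule radon_compact_measurable[OF radon haus K0(1)])
  have K0X: "K0 \<subseteq> X" using K0(2) by blast
  have "measure M (X - Z) = 1"
    using Z(2,3) prob_compl[of Z] by (simp add: space_M measure_def)
  then have K0_compl: "measure M (X - K0) < e / 2"
    using K0(3) prob_compl[OF K0M] by (simp add: space_M)
  \<comment> \<open>\<open>g\<close> is rounded in steps of \<open>e\<close>. \<open>Q\<close> steps
    reach \<open>L0\<close>, and where \<open>g\<close> is at least \<open>Q * e\<close> the global
    constant \<open>L = (Q + 1) * e\<close> serves.\<close>
  define Q where "Q = nat \<lceil>L0 / e\<rceil>"
  define L where "L = (real Q + 1) * e"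
  have Q1: "L0 \<le> real Q * e"
  proof -
    have "L0 / e \<le> real Q" unfolding Q_def by linarith
    then show ?thesis using e by (simp add: pos_divide_le_eq)
  qed
  have Q2: "real Q * e \<le> L0 + e"
  proof -
    have "real Q \<le> L0 / e + 1" unfolding Q_def using L0(1) e by (simp add: of_nat_nat)
    then have "real Q * e \<le> (L0 / e + 1) * e" using e by (intro mult_right_mono) auto
    then show ?thesis using e by (simp add: distrib_right)
  qed
  have L: "L > 0" "L0 \<le> L" "L \<le> L0 + 2 * e"
    using Q1 Q2 e by (auto simp: L_def distrib_right intro!: add_nonneg_pos)
  have lipL: "ennreal \<bar>h x - h y\<bar> \<le> ennreal L * d x y" if "x \<in> X" "y \<in> X" for x y
    using L0(2)[OF that] mult_right_mono[OF ennreal_leI[OF L(2)], of "d x y"] by simp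
  \<comment> \<open>One step above the level of \<open>g\<close>: then \<open>Lip_a\<close> is
    strictly below \<open>c q\<close>, which provides a scale at which \<open>h\<close> is
    \<open>c q\<close>-Lipschitz. The minimum keeps \<open>c q\<close> below \<open>L\<close> for
    every index.\<close>
  define c where "c q = (real (min q Q) + 1) * e" for q
  have c: "c q > 0" "c q \<le> L" for q
    using e by (auto simp: c_def L_def intro!: mult_pos_pos mult_right_mono add_nonneg_pos)
  define \<rho> where "\<rho> n = inverse (real (Suc n))" for n
  have \<rho>: "\<rho> n > 0" for n by (simp add: \<rho>_def)
  \<comment> \<open>\<open>q\<close> records the level of \<open>g\<close>, \<open>n\<close> the
    scale of the Lipschitz bound and \<open>p\<close> the slice of values of
    \<open>h\<close>.\<close>
  define B where "B = (\<lambda>(q, n, p). {x \<in> space M. ennreal (real (min q Q) * e) \<le> g x} \<inter>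
    {x \<in> K0. \<forall>y\<in>K0. d x y < ennreal (\<rho> n) \<longrightarrow> ennreal \<bar>h x - h y\<bar> \<le> ennreal (c q) * d x y} \<inter>
    {x \<in> space M. \<lfloor>h x / (c q * \<rho> n)\<rfloor> = p})"
  have BM: "B z \<in> sets M" for z
  proof -
    obtain q n p where z: "z = (q, n, p)" by (cases z)
    have [measurable]: "{x \<in> K0. \<forall>y\<in>K0. d x y < ennreal (\<rho> n) \<longrightarrow>
        ennreal \<bar>h x - h y\<bar> \<le> ennreal (c q) * d x y} \<in> sets M"
      by (rule local_Lipschitz_set_measurable[OF K0(1) h c(1) \<rho>])
    show ?thesis unfolding z B_def prod.case by measurable
  qed
  have "\<exists>z. x \<in> B z" if x: "x \<in> K0" for x
  proof -
    have xX: "x \<in> X" "x \<in> space M" using x K0X space_M by auto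
    have "\<exists>q n. ennreal (real (min q Q) * e) \<le> g x \<and>
        (\<forall>y\<in>K0. d x y < ennreal (\<rho> n) \<longrightarrow> ennreal \<bar>h x - h y\<bar> \<le> ennreal (c q) * d x y)"
    proof (cases "g x < ennreal (real Q * e)")
      case True
      define \<gamma> where "\<gamma> = enn2real (g x)"
      have \<gamma>: "g x = ennreal \<gamma>" "0 \<le> \<gamma>"
        using True by (auto simp: \<gamma>_def top_unique dest: less_trans[OF _ ennreal_less_top])
      define q where "q = nat \<lfloor>\<gamma> / e\<rfloor>"
      have "real q \<le> \<gamma> / e" "\<gamma> / e < real q + 1"
        unfolding q_def using \<gamma>(2) e by (simp_all add: of_nat_nat)
      then have q: "real q * e \<le> \<gamma>" "\<gamma> < (real q + 1) * e"
        using e by (simp_all add: pos_le_divide_eq pos_divide_less_eq)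
      have "\<gamma> < real Q * e" using True \<gamma> by (simp add: ennreal_less_iff)
      with q(1) have "real q * e < real Q * e" by linarith
      then have "q < Q" using e by simp
      then have min: "min q Q = q" by simp
      have "Lip_a T d h x \<le> g x" using Z(1) K0(2) x xX by auto
      also have "g x < ennreal (c q)" using \<gamma> q(2) by (simp add: c_def min ennreal_less_iff)
      finally obtain r where r: "r > 0" "\<And>y z. y \<in> X \<Longrightarrow> z \<in> X \<Longrightarrow> d y x < ennreal r \<Longrightarrow>
          d z x < ennreal r \<Longrightarrow> 0 < d y z \<Longrightarrow> ennreal \<bar>h y - h z\<bar> / d y z \<le> ennreal (c q)"
        by (rule Lip_a_lessE) blast
      obtain n where n: "\<rho> n < r" using reals_Archimedean[OF r(1)] by (auto simp: \<rho>_def)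
      have near: "ennreal \<bar>h x - h y\<bar> \<le> ennreal (c q) * d x y" if y: "y \<in> K0" "d x y < ennreal (\<rho> n)" for y
      proof (cases "x = y")
        case False
        have yX: "y \<in> X" using y K0X by blast
        have pos: "0 < d x y" using False d_eq_0_iff[OF xX(1) yX] by (simp add: zero_less_iff_neq_zero)
        have fin: "d x y < \<infinity>" using y(2) by (auto dest: less_trans[OF _ ennreal_less_top])
        have "d x y < ennreal r" using y(2) n by (meson ennreal_leI less_imp_le less_le_trans)
        then have "ennreal \<bar>h x - h y\<bar> / d x y \<le> ennreal (c q)"
          using r(2)[OF xX(1) yX] d_eq_0_iff[of x x] d_sym[OF xX(1) yX] xX(1) r(1) pos by simp
        then show ?thesis using pos fin by (rule ennreal_le_mult_of_divide_le)
      qed simp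
      have "ennreal (real (min q Q) * e) \<le> g x"
        using \<gamma> q(1) min by (simp add: ennreal_leI)
      with near show ?thesis by blast
    next
      case False
      have "c Q = L" by (simp add: c_def L_def)
      then have "ennreal \<bar>h x - h y\<bar> \<le> ennreal (c Q) * d x y" if "y \<in> K0" for y
        using lipL xX(1) K0X that by auto
      moreover have "ennreal (real (min Q Q) * e) \<le> g x"
        using False by (simp add: not_less)
      ultimately show ?thesis by blast
    qed
    then show ?thesis using x xX(2) by (auto simp: B_def)
  qed
  then have "K0 \<subseteq> (\<Union>z. B z)"
    by blast
  \<comment> \<open>The triples are countable, so the sets can be listed as a sequence.\<close>
  also have "\<dots> = (\<Union>n. B (from_nat n))"
    using surj_from_nat by (metis image_image)
  finally have cover: "K0 \<subseteq> (\<Union>n. B (from_nat n))" .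
  obtain N K where K: "\<And>n. compactin T (K n)" "\<And>n. K n \<subseteq> B (from_nat n)" "disjoint_family K"
    "measure M (K0 - (\<Union>n<N. K n)) < e / 2"
    by (rule radon_finite_compact_cover[OF radon haus, of "\<lambda>n. B (from_nat n)" K0 "e / 2"])
      (use BM K0M cover e in auto)
  have lipK: "ennreal \<bar>h x - h y\<bar> \<le> ennreal (c (fst z)) * d x y" if xy: "x \<in> B z" "y \<in> B z" for x y z
  proof -
    obtain q n p where z: "z = (q, n, p)" by (cases z)
    let ?w = "c q * \<rho> n"
    have K0xy: "x \<in> K0" "y \<in> K0" using xy by (auto simp: z B_def)
    show ?thesis
    proof (cases "d x y < ennreal (\<rho> n)")
      case True
      then show ?thesis using xy K0xy by (auto simp: z B_def)
    next
      case False
      have w: "?w > 0" using c \<rho> by simp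
      have "\<lfloor>h x / ?w\<rfloor> = \<lfloor>h y / ?w\<rfloor>" using xy by (auto simp: z B_def)
      then have "\<bar>h x / ?w - h y / ?w\<bar> \<le> 1" by linarith
      then have "\<bar>h x - h y\<bar> \<le> ?w"
        using w by (simp add: diff_divide_distrib[symmetric] abs_divide pos_divide_le_eq)
      then have "ennreal \<bar>h x - h y\<bar> \<le> ennreal (c q) * ennreal (\<rho> n)"
        using c[of q] \<rho>[of n] by (simp add: ennreal_mult[symmetric] ennreal_leI)
      also have "\<dots> \<le> ennreal (c q) * d x y"
        using False by (intro mult_left_mono) (auto simp: not_less)
      finally show ?thesis by (simp add: z)
    qed
  qed
  have c_le_g: "ennreal (c (fst z)) \<le> g x + ennreal e" if "x \<in> B z" for x z
  proof -
    obtain q n p where z: "z = (q, n, p)" by (cases z)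
    have "ennreal (c q) = ennreal (real (min q Q) * e) + ennreal e"
      using e by (simp add: c_def distrib_right ennreal_plus)
    also have "\<dots> \<le> g x + ennreal e"
      using that by (intro add_right_mono) (auto simp: z B_def)
    finally show ?thesis by (simp add: z)
  qed
  have KM[measurable]: "K n \<in> sets M" for n
    by (rule radon_compact_measurable[OF radon haus K(1)])
  have "measure M (X - (\<Union>n<N. K n)) \<le> measure M ((X - K0) \<union> (K0 - (\<Union>n<N. K n)))"
    using K0M KM by (intro finite_measure_mono) (auto simp: space_M[symmetric])
  also have "\<dots> \<le> measure M (X - K0) + measure M (K0 - (\<Union>n<N. K n))"
    using K0M KM by (intro measure_Un_le) (auto simp: space_M[symmetric])
  also have "\<dots> < e" using K0_compl K(4) by simp
  finally have "measure M (X - (\<Union>n<N. K n)) < e" .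
  moreover have "Lipschitz_cells h g e K (\<lambda>n. c (fst (from_nat n :: nat \<times> nat \<times> int))) L"
    unfolding Lipschitz_cells_def
  proof (intro conjI allI ballI)
    show "0 \<le> c (fst (from_nat n :: nat \<times> nat \<times> int))" for n
      using c(1) by (rule less_imp_le)
    show "ennreal (c (fst (from_nat n :: nat \<times> nat \<times> int))) \<le> g x + ennreal e" if "x \<in> K n" for n x
      using that K(2) by (intro c_le_g) blast+
    show "ennreal \<bar>h x - h y\<bar> \<le> ennreal (c (fst (from_nat n :: nat \<times> nat \<times> int))) * d x y"
      if "x \<in> K n" "y \<in> K n" for n x y
      using that K(2) by (intro lipK) blast+
  qed (fact K c)+
  ultimately show thesis
    using that L by blast
qed

text \<open>Dini's argument on the square of \<open>K\<close>:
  \<open>c * ds i x y + e - (h x - h y)\<close> increases with \<open>i\<close>, and at each pair it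
  becomes positive since its supremum is at least \<open>e\<close>.\<close>

lemma eventually_Lipschitz_on_compact:
  assumes K: "compactin T K" and h: "continuous_map T euclideanreal h" and c: "c \<ge> 0" and e: "e > 0"
    and lip: "\<And>x y. x \<in> K \<Longrightarrow> y \<in> K \<Longrightarrow> ennreal \<bar>h x - h y\<bar> \<le> ennreal c * d x y"
  shows "\<exists>i\<in>I. \<forall>j\<in>I. le i j \<longrightarrow> (\<forall>x\<in>K. \<forall>y\<in>K. h x - h y \<le> c * ds j x y + e)"
proof -
  let ?TT = "prod_topology T T"
  have KX: "K \<subseteq> X" by (rule compactin_subset_topspace[OF K])
  have hc: "continuous_map ?TT euclideanreal (\<lambda>p. h (fst p))" "continuous_map ?TT euclideanreal (\<lambda>p. h (snd p))"
    using continuous_map_compose[OF continuous_map_fst h] continuous_map_compose[OF continuous_map_snd h]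
    by (simp_all add: o_def)
  define \<phi> where "\<phi> i p = c * ds i (fst p) (snd p) + e - (h (fst p) - h (snd p))" for i and p :: "'a \<times> 'a"
  have "\<exists>i\<in>I. \<forall>j\<in>I. le i j \<longrightarrow> (\<forall>p\<in>K \<times> K. 0 < \<phi> j p)"
  proof (rule directed_eventually_pos_on_compact[OF dir])
    show "compactin ?TT (K \<times> K)" by (simp add: compactin_Times K)
    show "continuous_map ?TT euclideanreal (\<phi> i)" if "i \<in> I" for i
      unfolding \<phi>_def
      by (intro continuous_map_diff continuous_map_add continuous_map_real_mult_left ds_continuous that hc)
        auto
    show "\<phi> i p \<le> \<phi> j p" if "i \<in> I" "j \<in> I" "le i j" "p \<in> K \<times> K" for i j p
    proof -
      have "ds i (fst p) (snd p) \<le> ds j (fst p) (snd p)"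
        using that KX by (intro ds_mono) auto
      then show ?thesis using c by (simp add: \<phi>_def mult_left_mono)
    qed
    fix p assume "p \<in> K \<times> K"
    then obtain x y where p: "p = (x, y)" "x \<in> K" "y \<in> K" by auto
    have X: "x \<in> X" "y \<in> X" using p KX by auto
    show "\<exists>i\<in>I. 0 < \<phi> i p"
    proof (rule ccontr)
      assume "\<not> ?thesis"
      then have le: "c * ds i x y \<le> h x - h y - e" if "i \<in> I" for i
        using that by (force simp: \<phi>_def p not_less)
      show False
      \<comment> \<open>For \<open>c = 0\<close> the hypothesis makes \<open>h\<close> constant on
        \<open>K\<close>, even at infinite distance; otherwise the inequality is divided by
        \<open>c\<close>.\<close>
      proof (cases "c = 0")
        case True
        have "h x - h y \<le> 0" using lip[OF p(2,3)] True by simp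
        moreover obtain i where "i \<in> I" using I_nonempty by blast
        ultimately show False using le[of i] True e by simp
      next
        case False
        then have c0: "c > 0" using c by simp
        have le': "ds i x y \<le> (h x - h y - e) / c" if "i \<in> I" for i
          using le[OF that] c0 by (simp add: pos_le_divide_eq mult.commute)
        note d_le = d_leI[OF X le']
        have "ennreal \<bar>h x - h y\<bar> \<le> ennreal c * ennreal ((h x - h y - e) / c)"
          by (rule order_trans[OF lip[OF p(2,3)]]) (intro mult_left_mono d_le(2), simp_all)
        also have "\<dots> = ennreal (h x - h y - e)"
          using d_le(1) c0 by (simp add: ennreal_mult[symmetric])
        finally have "\<bar>h x - h y\<bar> \<le> h x - h y - e"
          using d_le(1) c0 by (simp add: ennreal_le_iff zero_le_divide_iff)
        then show False using e by linarith
      qed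
    qed
  qed
  then obtain i where i: "i \<in> I" "\<And>j p. j \<in> I \<Longrightarrow> le i j \<Longrightarrow> p \<in> K \<times> K \<Longrightarrow> 0 < \<phi> j p"
    by blast
  show ?thesis
  proof (rule bexI[OF _ i(1)], intro ballI impI)
    fix j x y assume "j \<in> I" "le i j" "x \<in> K" "y \<in> K"
    then show "h x - h y \<le> c * ds j x y + e"
      using i(2)[of j "(x, y)"] by (simp add: \<phi>_def)
  qed
qed

text \<open>Pairs from different cells form a compact set on which \<open>d\<close> is positive, so
  some \<open>ds i\<close> is positive there and has a positive lower bound, which persists for
  later indices by monotonicity.\<close>

lemma eventually_separated:
  assumes K: "\<And>n::nat. compactin T (K n)" and disj: "disjoint_family K"
  obtains i s where "i \<in> I" "s > 0"
    "\<And>j n m x y. j \<in> I \<Longrightarrow> le i j \<Longrightarrow> n < N \<Longrightarrow> m < N \<Longrightarrow> n \<noteq> m \<Longrightarrow> x \<in> K n \<Longrightarrow> y \<in> K m \<Longrightarrow> s \<le> ds j x y"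
proof -
  let ?TT = "prod_topology T T"
  define P where "P = {(n, m). n < N \<and> m < N \<and> n \<noteq> m}"
  have "P \<subseteq> {..<N} \<times> {..<N}" by (auto simp: P_def)
  then have finP: "finite P" by (rule finite_subset) simp
  define C where "C = (\<Union>(n, m)\<in>P. K n \<times> K m)"
  have KX: "K n \<subseteq> X" for n by (rule compactin_subset_topspace[OF K])
  have C: "compactin ?TT C"
    unfolding C_def by (rule compactin_Union) (use finP K in \<open>auto simp: compactin_Times\<close>)
  have CX: "fst p \<in> X" "snd p \<in> X" if "p \<in> C" for p
    using that KX[THEN subsetD] by (auto simp: C_def)
  have "\<exists>i\<in>I. \<forall>j\<in>I. le i j \<longrightarrow> (\<forall>p\<in>C. 0 < ds j (fst p) (snd p))"
  proof (rule directed_eventually_pos_on_compact[OF dir C ds_continuous])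
    fix p assume p: "p \<in> C"
    have "fst p \<noteq> snd p"
      using p disj by (auto simp: C_def P_def disjoint_family_on_def) blast
    then have "d (fst p) (snd p) \<noteq> 0"
      using CX[OF p] by (simp add: d_eq_0_iff)
    then show "\<exists>i\<in>I. 0 < ds i (fst p) (snd p)"
      using d_leI(2)[OF CX[OF p], of 0] by (force simp: not_less)
  qed (use ds_mono CX in auto)
  then obtain i where i: "i \<in> I" "\<And>j p. j \<in> I \<Longrightarrow> le i j \<Longrightarrow> p \<in> C \<Longrightarrow> 0 < ds j (fst p) (snd p)"
    by blast
  have "le i i" using dir i(1) by (simp add: directed_set_def)
  then obtain s where s: "s > 0" "\<And>p. p \<in> C \<Longrightarrow> s \<le> ds i (fst p) (snd p)"
    using compactin_pos_lower_bound[OF C ds_continuous[OF i(1)] i(2)[OF i(1)]] by blast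
  show thesis
  proof (rule that[OF i(1) s(1)])
    fix j n m x y assume A: "j \<in> I" "le i j" "n < N" "m < N" "n \<noteq> m" "x \<in> K n" "y \<in> K m"
    then have "(x, y) \<in> C" by (auto simp: C_def P_def)
    with s(2) CX have "s \<le> ds i x y" "x \<in> X" "y \<in> X" by fastforce+
    with ds_mono[OF i(1) A(1,2), of x y] show "s \<le> ds j x y" by linarith
  qed
qed

text \<open>The number of cells enters only through the separation \<open>s\<close>, hence through the choice of \<open>i\<close>:
  the Lipschitz constant \<open>5 * L\<close> of the glued function, which governs its energy outside of the
  cells, is bounded in terms of \<open>L0\<close> alone.\<close>

lemma Lip_b_approximation:
  assumes h: "continuous_map T euclideanreal h" and hB: "\<And>x. x \<in> X \<Longrightarrow> \<bar>h x\<bar> \<le> B"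
    and L0: "L0 \<ge> 0" "\<And>x y. x \<in> X \<Longrightarrow> y \<in> X \<Longrightarrow> ennreal \<bar>h x - h y\<bar> \<le> ennreal L0 * d x y"
    and g[measurable]: "g \<in> borel_measurable M" and AE_g: "AE x in M. Lip_a T d h x \<le> g x"
    and e: "0 < e" "e \<le> 1"
  shows "\<exists>i\<in>I. \<exists>v\<in>L2_set_of M. (\<integral>\<^sup>+x. ennreal ((v x - h x)\<^sup>2) \<partial>M) \<le> ennreal (e * (1 + 4 * B\<^sup>2)) \<and>
    Cheeger_semidist T (ds i) M v \<le>
      ennreal (1 + e) * (\<integral>\<^sup>+x. (g x)\<^sup>2 \<partial>M) + ennreal (e * (2 + 25 * (L0 + 2)\<^sup>2))"
proof -
  interpret prob_space M by (rule radon_prob_measureD(1)[OF radon])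
  have space_M: "space M = X" by (rule radon_prob_measureD(2)[OF radon])
  obtain N :: nat and K c L where cells: "Lipschitz_cells h g e K c L" 
    and L: "L > 0" "L \<le> L0 + 2 * e" and "L0 \<le> L"
    and small: "measure M (X - (\<Union>n<N. K n)) < e"
    by (rule Lipschitz_partition[OF h L0 g AE_g e(1)]) blast
  have lipL: "ennreal \<bar>h x - h y\<bar> \<le> ennreal L * d x y" if "x \<in> X" "y \<in> X" for x y
    using L0(2)[OF that] mult_right_mono[OF ennreal_leI[OF \<open>L0 \<le> L\<close>], of "d x y"] by simp
  from cells have K: "\<And>n. compactin T (K n)" "disjoint_family K"
    and c: "\<And>n. 0 \<le> c n" "\<And>n. c n \<le> L"
    and lipK: "\<And>n x y. x \<in> K n \<Longrightarrow> y \<in> K n \<Longrightarrow> ennreal \<bar>h x - h y\<bar> \<le> ennreal (c n) * d x y"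
    and cg: "\<And>n x. x \<in> K n \<Longrightarrow> ennreal (c n) \<le> g x + ennreal e"
    unfolding Lipschitz_cells_def by blast+
  have KX: "K n \<subseteq> X" for n by (rule compactin_subset_topspace[OF K(1)])
  have KM[measurable]: "K n \<in> sets M" for n
    by (rule radon_compact_measurable[OF radon haus K(1)])
  define U where "U = (\<Union>n<N. K n)"
  have UX: "U \<subseteq> X" using KX by (auto simp: U_def)
  have UM[measurable]: "U \<in> sets M" unfolding U_def by measurable
  have U_compact: "compactin T U"
    unfolding U_def by (rule compactin_Union) (use K in auto)
  \<comment> \<open>The gluing needs a nonempty piece. With \<open>U\<close> empty, the whole space
    of mass 1 would have measure below \<open>e\<close>, contradicting
    \<open>e <= 1\<close>.\<close>
  have "U \<noteq> {}"
  proof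
    assume "U = {}"
    then have "measure M (space M) < e" using small by (simp add: U_def space_M)
    then show False using e(2) prob_space by simp
  qed
  obtain i1 s0 where s0: "i1 \<in> I" "s0 > 0" "\<And>j n m x y. j \<in> I \<Longrightarrow> le i1 j \<Longrightarrow> n < N \<Longrightarrow> m < N \<Longrightarrow>
      n \<noteq> m \<Longrightarrow> x \<in> K n \<Longrightarrow> y \<in> K m \<Longrightarrow> s0 \<le> ds j x y"
    by (rule eventually_separated[OF K, of N]) blast
  \<comment> \<open>These constants match the hypotheses of
    \<open>separated_Lipschitz_gluing\<close>. The order matters: the separation is fixed first,
    then the additive error \<open>e1\<close>, and only then the indices at which that error is
    reached.\<close>
  define s where "s = s0 / 4"
  define e1 where "e1 = min e (L * s / 2)"
  have s: "s > 0" using s0(2) by (simp add: s_def)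
  have e1: "0 < e1" "e1 \<le> e" "2 * e1 \<le> L * s"
    using e L(1) s by (auto simp: e1_def)
  have "\<exists>i\<in>I. \<forall>j\<in>I. le i j \<longrightarrow> (\<forall>n\<in>{..<N}. \<forall>x\<in>K n. \<forall>y\<in>K n. h x - h y \<le> c n * ds j x y + e1)"
    by (intro directed_eventually_ball_finite[OF dir] eventually_Lipschitz_on_compact K h c e1 lipK) auto
  then obtain i2 where i2: "i2 \<in> I" "\<And>j n x y. j \<in> I \<Longrightarrow> le i2 j \<Longrightarrow> n < N \<Longrightarrow> x \<in> K n \<Longrightarrow> y \<in> K n \<Longrightarrow>
      h x - h y \<le> c n * ds j x y + e1"
    by (meson lessThan_iff)
  obtain i3 where i3: "i3 \<in> I" "\<And>j x y. j \<in> I \<Longrightarrow> le i3 j \<Longrightarrow> x \<in> U \<Longrightarrow> y \<in> U \<Longrightarrow>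
      h x - h y \<le> L * ds j x y + e1"
    using eventually_Lipschitz_on_compact[OF U_compact h less_imp_le[OF L(1)] e1(1)] lipL UX by blast
  obtain i where i: "i \<in> I" "le i1 i" "le i2 i" "le i3 i"
    using directed_finite_upper_bound[OF dir, of "{i1, i2, i3}"] s0(1) i2(1) i3(1) by auto
  interpret Q: semidist_quotient T "ds i" M
    by unfold_locales (fact ds[OF i(1)] radon)+
  have "\<exists>v. (\<forall>u. \<bar>v u\<bar> \<le> B) \<and> (\<forall>u\<in>X. \<forall>w\<in>X. \<bar>v u - v w\<bar> \<le> 5 * L * ds i u w) \<and>
      (\<forall>n<N. \<forall>x\<in>K n. \<bar>v x - h x\<bar> \<le> e1) \<and>
      (\<forall>n<N. \<forall>x\<in>K n. \<forall>u\<in>X. \<forall>w\<in>X. ds i u x < s / 2 \<longrightarrow> ds i w x < s / 2 \<longrightarrow> \<bar>v u - v w\<bar> \<le> c n * ds i u w)"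
  proof (rule separated_Lipschitz_gluing[of X "ds i" "{..<N}" K c L s h B e1])
    show "\<exists>n\<in>{..<N}. K n \<noteq> {}" using \<open>U \<noteq> {}\<close> by (auto simp: U_def)
    show "4 * s \<le> ds i x y" if "n \<in> {..<N}" "m \<in> {..<N}" "n \<noteq> m" "x \<in> K n" "y \<in> K m" for n m x y
      using s0(3)[of i n m x y] that i by (simp add: s_def)
    show "h x - h y \<le> L * ds i x y + e1" if "n \<in> {..<N}" "m \<in> {..<N}" "x \<in> K n" "y \<in> K m" for n m x y
      using i3(2)[of i x y] that i by (auto simp: U_def)
  qed (use Q.semidist KX c L s e1 hB i i2 in \<open>(auto; fail)+ | blast\<close>)+
  then obtain v where v: "\<And>u. \<bar>v u\<bar> \<le> B" "\<And>u w. u \<in> X \<Longrightarrow> w \<in> X \<Longrightarrow> \<bar>v u - v w\<bar> \<le> 5 * L * ds i u w"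
      "\<And>n x. n < N \<Longrightarrow> x \<in> K n \<Longrightarrow> \<bar>v x - h x\<bar> \<le> e1"
      "\<And>n x u w. n < N \<Longrightarrow> x \<in> K n \<Longrightarrow> u \<in> X \<Longrightarrow> w \<in> X \<Longrightarrow> ds i u x < s / 2 \<Longrightarrow> ds i w x < s / 2 \<Longrightarrow>
        \<bar>v u - v w\<bar> \<le> c n * ds i u w"
    by blast
  \<comment> \<open>On the cells the local slope \<open>c n\<close> is at most \<open>g + e\<close>;
    elsewhere only the global constant is available, on a set of measure at most
    \<open>e\<close>.\<close>
  define C where "C x = (if x \<in> U then g x + ennreal e else ennreal (5 * L))" for x
  have loc: "\<exists>r>0. \<forall>y\<in>X. \<forall>z\<in>X. ds i y x < r \<longrightarrow> ds i z x < r \<longrightarrow>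
      ennreal \<bar>v y - v z\<bar> \<le> C x * ennreal (ds i y z)" if x: "x \<in> X" for x
  proof (cases "x \<in> U")
    case True
    then obtain n where n: "n < N" "x \<in> K n" by (auto simp: U_def)
    have "ennreal \<bar>v y - v z\<bar> \<le> C x * ennreal (ds i y z)"
      if yz: "y \<in> X" "z \<in> X" "ds i y x < s / 2" "ds i z x < s / 2" for y z
    proof -
      have "ennreal \<bar>v y - v z\<bar> \<le> ennreal (c n * ds i y z)"
        by (intro ennreal_leI v(4)[OF n]) (fact yz)+
      also have "\<dots> = ennreal (c n) * ennreal (ds i y z)"
        using c ds_nonneg[OF i(1) yz(1,2)] by (simp add: ennreal_mult)
      also have "\<dots> \<le> C x * ennreal (ds i y z)"
        using cg[OF n(2)] True by (intro mult_right_mono) (auto simp: C_def)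
      finally show ?thesis .
    qed
    then show ?thesis using s by (intro exI[of _ "s / 2"]) auto
  next
    case False
    have "ennreal \<bar>v y - v z\<bar> \<le> C x * ennreal (ds i y z)" if yz: "y \<in> X" "z \<in> X" for y z
    proof -
      have "ennreal \<bar>v y - v z\<bar> \<le> ennreal (5 * L * ds i y z)"
        by (intro ennreal_leI v(2) yz)
      then show ?thesis
        using False L(1) ds_nonneg[OF i(1) yz] by (simp add: C_def ennreal_mult)
    qed
    then show ?thesis by (intro exI[of _ 1]) auto
  qed
  have lip5: "5 * L \<ge> 0" using L(1) by simp
  note Q_le = Q.Cheeger_semidist_le[of v B "5 * L" C, OF v(1) lip5 v(2) loc]
  have XU: "emeasure M (X - U) \<le> ennreal e"
    using small by (simp add: emeasure_eq_measure U_def ennreal_leI)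
  have XUM[measurable]: "X - U \<in> sets M"
    using UM by (simp add: space_M[symmetric])
  have "(\<integral>\<^sup>+x. (C x)\<^sup>2 \<partial>M) \<le> (\<integral>\<^sup>+x. ennreal (1 + e) * (g x)\<^sup>2 + ennreal (e + e\<^sup>2) +
      ennreal (25 * L\<^sup>2) * indicator (X - U) x \<partial>M)"
  proof (rule nn_integral_mono)
    fix x assume x: "x \<in> space M"
    show "(C x)\<^sup>2 \<le> ennreal (1 + e) * (g x)\<^sup>2 + ennreal (e + e\<^sup>2) + ennreal (25 * L\<^sup>2) * indicator (X - U) x"
    proof (cases "x \<in> U")
      case True
      then show ?thesis using ennreal_square_add_le[of e "g x"] e by (simp add: C_def)
    next
      case False
      then have "(C x)\<^sup>2 = ennreal (25 * L\<^sup>2) * indicator (X - U) x"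
        using x L(1) by (simp add: C_def space_M ennreal_power power_mult_distrib)
      then show ?thesis by (metis add.commute add_increasing2 order_refl zero_le)
    qed
  qed
  also have "\<dots> = ennreal (1 + e) * (\<integral>\<^sup>+x. (g x)\<^sup>2 \<partial>M) + ennreal (e + e\<^sup>2) + ennreal (25 * L\<^sup>2) * emeasure M (X - U)"
    by (simp add: nn_integral_add nn_integral_cmult emeasure_space_1)
  also have "\<dots> \<le> ennreal (1 + e) * (\<integral>\<^sup>+x. (g x)\<^sup>2 \<partial>M) + (ennreal (e + e\<^sup>2) + ennreal (25 * L\<^sup>2) * ennreal e)"
    unfolding add.assoc by (intro add_left_mono mult_left_mono XU) simp
  also have "ennreal (e + e\<^sup>2) + ennreal (25 * L\<^sup>2) * ennreal e = ennreal (e + e\<^sup>2 + 25 * L\<^sup>2 * e)"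
    using e by (simp add: ennreal_mult ennreal_plus)
  \<comment> \<open>From \<open>e <= 1\<close> follow \<open>L <= L0 + 2\<close> and
    \<open>e^2 <= e\<close>, so the error is \<open>e\<close> times a constant fixed by
    \<open>L0\<close>.\<close>
  also have "\<dots> \<le> ennreal (e * (2 + 25 * (L0 + 2)\<^sup>2))"
  proof (rule ennreal_leI)
    have "L\<^sup>2 \<le> (L0 + 2)\<^sup>2" using L L0(1) e by (intro power_mono) auto
    then have "e * (25 * L\<^sup>2) \<le> e * (25 * (L0 + 2)\<^sup>2)" using e by (intro mult_left_mono) auto
    moreover have "e\<^sup>2 \<le> e" using e by (simp add: power2_eq_square mult_left_le)
    ultimately show "e + e\<^sup>2 + 25 * L\<^sup>2 * e \<le> e * (2 + 25 * (L0 + 2)\<^sup>2)"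
      by (simp add: algebra_simps)
  qed
  finally have energy: "Cheeger_semidist T (ds i) M v \<le>
      ennreal (1 + e) * (\<integral>\<^sup>+x. (g x)\<^sup>2 \<partial>M) + ennreal (e * (2 + 25 * (L0 + 2)\<^sup>2))"
    using Q_le(2) by (meson add_left_mono order_trans)
  \<comment> \<open>On \<open>U\<close> the difference is at most \<open>e1\<close>, whose square is
    at most \<open>e\<close>; off \<open>U\<close> it is at most \<open>2 * B\<close> on a set of
    measure at most \<open>e\<close>.\<close>
  have "(\<integral>\<^sup>+x. ennreal ((v x - h x)\<^sup>2) \<partial>M) \<le> (\<integral>\<^sup>+x. ennreal e + ennreal (4 * B\<^sup>2) * indicator (X - U) x \<partial>M)"
  proof (rule nn_integral_mono)
    fix x assume x: "x \<in> space M"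
    show "ennreal ((v x - h x)\<^sup>2) \<le> ennreal e + ennreal (4 * B\<^sup>2) * indicator (X - U) x"
    proof (cases "x \<in> U")
      case True
      then have "\<bar>v x - h x\<bar> \<le> e1" using v(3) by (auto simp: U_def)
      then have "(v x - h x)\<^sup>2 \<le> e1\<^sup>2" using e1(1) by (simp add: abs_le_square_iff[symmetric])
      also have "\<dots> \<le> e * 1" unfolding power2_eq_square using e e1 by (intro mult_mono) auto
      finally show ?thesis using True by (simp add: ennreal_leI)
    next
      case False
      have "\<bar>v x - h x\<bar> \<le> 2 * B" using v(1)[of x] hB[of x] x space_M by auto
      then have "(v x - h x)\<^sup>2 \<le> (2 * B)\<^sup>2"
        using abs_le_square_iff[of "v x - h x" "2 * B"] by linarith
      then have "ennreal ((v x - h x)\<^sup>2) \<le> ennreal (4 * B\<^sup>2)" by (simp add: power_mult_distrib ennreal_leI)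
      also have "\<dots> \<le> ennreal e + ennreal (4 * B\<^sup>2)" by simp
      finally show ?thesis using False x by (simp add: space_M)
    qed
  qed
  also have "\<dots> = ennreal e + ennreal (4 * B\<^sup>2) * emeasure M (X - U)"
    by (simp add: nn_integral_add nn_integral_cmult emeasure_space_1)
  also have "\<dots> \<le> ennreal e + ennreal (4 * B\<^sup>2) * ennreal e"
    by (intro add_left_mono mult_left_mono XU) simp
  also have "\<dots> = ennreal (e * (1 + 4 * B\<^sup>2))"
    using e by (simp add: ennreal_mult[symmetric] ennreal_plus[symmetric] algebra_simps del: ennreal_plus)
  finally show ?thesis
    using energy Q_le(1) i(1) by blast
qed

section \<open>Lower semicontinuous minorants and the comparison of energies\<close>

lemma L2_lsc_le_energy:
  assumes H: "L2_lsc M H"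
    and HG: "\<And>f i. f \<in> L2_set_of M \<Longrightarrow> i \<in> I \<Longrightarrow> H f \<le> enn2ereal (Cheeger_semidist T (ds i) M f)"
    and h: "h \<in> L2_set_of M" "Cheeger_competitor T d M (ennreal t) h" and t: "t \<ge> 0"
  shows "H h \<le> ereal t"
proof (rule ereal_le_epsilon2)
  fix \<eta> :: real assume \<eta>: "\<eta> > 0"
  obtain g where g: "g \<in> borel_measurable M" "AE x in M. Lip_a T d h x \<le> g x" "(\<integral>\<^sup>+x. (g x)\<^sup>2 \<partial>M) \<le> ennreal t"
    using h(2) unfolding Cheeger_competitor_def by blast
  have hb: "h \<in> Lip_b T d"
    using h(2) unfolding Cheeger_competitor_def by blast
  then have hc: "continuous_map T euclideanreal h" and "bounded (h ` X)"
    by (simp_all add: Lip_b_def)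
  then obtain B where B: "\<And>x. x \<in> X \<Longrightarrow> \<bar>h x\<bar> \<le> B"
    by (auto simp: bounded_iff)
  obtain L0 where L0: "L0 \<ge> 0" "\<And>x y. x \<in> X \<Longrightarrow> y \<in> X \<Longrightarrow> ennreal \<bar>h x - h y\<bar> \<le> ennreal L0 * d x y"
    using hb unfolding Lip_b_def by blast
  \<comment> \<open>The approximants come from \<open>Lip_b_approximation\<close>. Their index
    \<open>i\<close> varies with the precision, which is harmless because \<open>H\<close> lies
    below all the energies.\<close>
  have "H h \<le> ereal (t + \<eta>)"
  proof (rule L2_lsc_leI[OF H h(1)])
    fix \<epsilon> :: real assume \<epsilon>: "\<epsilon> > 0"
    define a where "a = 1 + 4 * B\<^sup>2"
    define b where "b = t + (2 + 25 * (L0 + 2)\<^sup>2)"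
    have ab: "a > 0" "b > 0" 
      using t zero_le_power2[of B] zero_le_power2[of "L0 + 2"] unfolding a_def b_def by linarith+
    \<comment> \<open>The squared L2 error \<open>e * a\<close> stays below \<epsilon> thanks to the
      factor 2, and the excess \<open>e * b\<close> of the energy over \<open>t\<close> is at most
      \<eta>; the summand \<open>t\<close> of \<open>b\<close> pays for the factor
      \<open>1 + e\<close>.\<close>
    define e where "e = min 1 (min (\<epsilon> / (2 * a)) (\<eta> / b))"
    have e: "0 < e" "e \<le> 1" using \<epsilon> \<eta> ab by (auto simp: e_def)
    have "e * a \<le> \<epsilon> / (2 * a) * a" "e * b \<le> \<eta> / b * b"
      using ab unfolding e_def by (intro mult_right_mono; simp)+
    then have ea: "e * a < \<epsilon>" and eb: "e * b \<le> \<eta>"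
      using ab \<epsilon> by auto
    obtain i v where iv: "i \<in> I" "v \<in> L2_set_of M" "(\<integral>\<^sup>+x. ennreal ((v x - h x)\<^sup>2) \<partial>M) \<le> ennreal (e * a)"
      "Cheeger_semidist T (ds i) M v \<le>
        ennreal (1 + e) * (\<integral>\<^sup>+x. (g x)\<^sup>2 \<partial>M) + ennreal (e * (2 + 25 * (L0 + 2)\<^sup>2))"
      using Lip_b_approximation[OF hc B L0 g(1,2) e] unfolding a_def by blast
    have "(\<integral>\<^sup>+x. ennreal ((v x - h x)\<^sup>2) \<partial>M) < ennreal \<epsilon>"
      using iv(3) ea \<epsilon> by (meson ennreal_lessI le_less_trans)
    moreover have "H v \<le> ereal (t + \<eta>)"
    proof -
      have "Cheeger_semidist T (ds i) M v \<le> ennreal (1 + e) * ennreal t + ennreal (e * (2 + 25 * (L0 + 2)\<^sup>2))"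
        using iv(4) by (rule order_trans) (intro add_right_mono mult_left_mono g(3), simp)
      also have "\<dots> = ennreal (t + e * b)"
        using e t by (simp add: ennreal_mult[symmetric] ennreal_plus[symmetric] b_def algebra_simps del: ennreal_plus)
      also have "\<dots> \<le> ennreal (t + \<eta>)" using eb by (intro ennreal_leI) simp
      finally have "enn2ereal (Cheeger_semidist T (ds i) M v) \<le> enn2ereal (ennreal (t + \<eta>))"
        by (simp add: less_eq_ennreal.rep_eq)
      also have "enn2ereal (ennreal (t + \<eta>)) = ereal (t + \<eta>)"
        using t \<eta> by (intro enn2ereal_ennreal) simp
      finally show ?thesis using HG[OF iv(2,1)] by (rule order_trans[rotated])
    qed
    ultimately show "\<exists>v\<in>L2_set_of M. (\<integral>\<^sup>+x. ennreal ((v x - h x)\<^sup>2) \<partial>M) < ennreal \<epsilon> \<and> H v \<le> ereal (t + \<eta>)"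
      using iv(2) by blast
  qed
  then show "H h \<le> ereal t + ereal \<eta>" by simp
qed

text \<open>For a real \<open>t\<close> strictly above the energy of \<open>f\<close>, competitors
  at level \<open>t\<close> come arbitrarily close to \<open>f\<close>; \<open>H\<close> is at most
  \<open>t\<close> on them by \<open>L2_lsc_le_energy\<close>, hence also at \<open>f\<close>. A
  \<open>t\<close> strictly between the two sides would give a contradiction.\<close>

lemma L2_lsc_le_Cheeger:
  assumes H: "L2_lsc M H"
    and HG: "\<And>f i. f \<in> L2_set_of M \<Longrightarrow> i \<in> I \<Longrightarrow> H f \<le> enn2ereal (Cheeger_semidist T (ds i) M f)"
    and f: "f \<in> L2_set_of M"
  shows "H f \<le> enn2ereal (Cheeger T d M f)"
proof (rule ccontr)
  assume "\<not> ?thesis"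
  then obtain t where t: "enn2ereal (Cheeger T d M f) < ereal t" "ereal t < H f"
    using ereal_dense2[of "enn2ereal (Cheeger T d M f)" "H f"] by (auto simp: not_le)
  have t0: "t \<ge> 0"
    using le_less_trans[OF enn2ereal_nonneg t(1)] by simp
  then have lt: "Cheeger T d M f < ennreal t"
    using t(1) by (simp add: less_ennreal.rep_eq enn2ereal_ennreal)
  have "H f \<le> ereal t"
  proof (rule L2_lsc_leI[OF H f])
    fix e :: real assume "e > 0"
    from Cheeger_lessE[OF lt this]
    obtain u where u: "u \<in> L2_set_of M" "(\<integral>\<^sup>+x. ennreal ((u x - f x)\<^sup>2) \<partial>M) < ennreal e"
      "Cheeger_competitor T d M (ennreal t) u"
      by blast
    with L2_lsc_le_energy[OF H HG u(1,3) t0]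
    show "\<exists>v\<in>L2_set_of M. (\<integral>\<^sup>+x. ennreal ((v x - f x)\<^sup>2) \<partial>M) < ennreal e \<and> H v \<le> ereal t"
      by blast
  qed
  with t(2) show False by simp
qed

lemma Cheeger_le_INF:
  assumes "f \<in> L2_set_of M"
  shows "Cheeger T d M f \<le> (INF i\<in>I. Cheeger_semidist T (ds i) M f)"
proof (rule INF_greatest)
  fix i assume i: "i \<in> I"
  interpret Q: semidist_quotient T "ds i" M
    by unfold_locales (fact ds[OF i] radon)+
  show "Cheeger T d M f \<le> Cheeger_semidist T (ds i) M f"
    by (rule Q.Cheeger_le_Cheeger_semidist[OF ds_le_d[OF i] assms])
qed

end

theorem theorem9p1:
  fixes T :: "'a topology" and d :: "'a \<Rightarrow> 'a \<Rightarrow> ennreal" and M :: "'a measure"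
    and I :: "'i set" and le :: "'i \<Rightarrow> 'i \<Rightarrow> bool" and ds :: "'i \<Rightarrow> 'a \<Rightarrow> 'a \<Rightarrow> real"
  assumes "extended_metric_topological_space T d"
    and "radon_prob_measure T M"
    and "directed_set I le"
    and "\<And>i. i \<in> I \<Longrightarrow> cont_bounded_semidistance T (ds i)"
    and "\<And>i j x y. i \<in> I \<Longrightarrow> j \<in> I \<Longrightarrow> le i j \<Longrightarrow> x \<in> topspace T \<Longrightarrow> y \<in> topspace T \<Longrightarrow>
           ds i x y \<le> ds j x y"
    and "\<And>x y. x \<in> topspace T \<Longrightarrow> y \<in> topspace T \<Longrightarrow> d x y = (SUP i\<in>I. ennreal (ds i x y))"
  shows "largest_L2_lsc_below M
           (\<lambda>f. enn2ereal (INF i\<in>I. Cheeger_semidist T (ds i) M f))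
           (\<lambda>f. enn2ereal (Cheeger T d M f))"
proof -
  interpret monotone_semidistances T d M I le ds
    by unfold_locales (fact assms)+
  show ?thesis
    unfolding largest_L2_lsc_below_def
  proof (intro conjI L2_lsc_Cheeger ballI allI impI)
    fix f assume "f \<in> L2_set_of M"
    then show "enn2ereal (Cheeger T d M f) \<le> enn2ereal (INF i\<in>I. Cheeger_semidist T (ds i) M f)"
      using Cheeger_le_INF by (simp add: less_eq_ennreal.rep_eq)
  next
    fix H f
    assume H: "L2_lsc M H \<and> (\<forall>f\<in>L2_set_of M. H f \<le> enn2ereal (INF i\<in>I. Cheeger_semidist T (ds i) M f))"
      and f: "f \<in> L2_set_of M"
    have "H f \<le> enn2ereal (Cheeger_semidist T (ds i) M f)" if "f \<in> L2_set_of M" "i \<in> I" for f i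
    proof -
      have "H f \<le> enn2ereal (INF i\<in>I. Cheeger_semidist T (ds i) M f)"
        using H that by blast
      also have "\<dots> \<le> enn2ereal (Cheeger_semidist T (ds i) M f)"
        using INF_lower[OF that(2), of "\<lambda>i. Cheeger_semidist T (ds i) M f"]
        by (simp add: less_eq_ennreal.rep_eq)
      finally show ?thesis .
    qed
    with H f show "H f \<le> enn2ereal (Cheeger T d M f)"
      using L2_lsc_le_Cheeger by blast
  qed
qed

end
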